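(* Let $\mathfrak g$ be a finite-dimensional Lie algebra over $\mathbb K=\mathbb R$ or $\mathbb C$ with an ad-invariant metric $g$. Then: (i) for $\mathbb K=\mathbb C$, $g$ is solitary if and only if every ad-invariant metric on $\mathfrak g$ has the form $g(\psi\cdot,\psi\cdot)$ for some $\psi\in\mathrm{Aut}(\mathfrak g)$; (ii) for $\mathbb K=\mathbb R$ and $\mathfrak g$ irreducible, $g$ is solitary if and only if every ad-invariant metric on $\mathfrak g$ has the form $g(\psi\cdot,\psi\cdot)$ or $-g(\psi\cdot,\psi\cdot)$ for some $\psi\in\mathrm{Aut}(\mathfrak g)$; (iii) for $\mathbb K=\mathbb R$ and $\mathfrak g$ reducible, fix a decomposition $\mathfrak g=\mathfrak g_1\oplus\dots\oplus\mathfrak g_k$ into irreducible, mutually $g$-orthogonal ideals, and decompose accordingly $g=g_1+\dots+g_k$; then $g$ is solitary if and only if every ad-invariant metric on $\mathfrak g$ has the form $h(\psi\cdot,\psi\cdot)$ for some $\psi\in\mathrm{Aut}(\mathfrak g)$ and some $h=\pm g_1\pm\dots\pm g_k$ (some choice of signs).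
   Context: A metric on a Lie algebra $\mathfrak g$ is a nondegenerate symmetric $\mathbb K$-bilinear form $g$; it is ad-invariant if $g([X,Y],Z)=-g(Y,[X,Z])$ for all $X,Y,Z\in\mathfrak g$. A linear map $\phi\colon\mathfrak g\to\mathfrak g$ is ad-invariant if $\phi([X,Y])=[X,\phi(Y)]$ for all $X,Y$. For a linear map $f$, $f^{*_g}$ denotes its adjoint with respect to $g$. An ad-invariant metric $g$ is solitary if every ad-invariant $g$-self-adjoint linear map $\phi\colon\mathfrak g\to\mathfrak g$ can be written as $\phi=D+D^{*_g}$ for some derivation $D$ of $\mathfrak g$. A Lie algebra is reducible if it is a direct sum of two nontrivial ideals, and irreducible otherwise. *)

theory Defs
  imports Complex_Main "HOL-Library.FuncSet"
begin

text \<open>Only meaningful when the adjoint exists and is unique, which is the case for a linear map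
  and a metric on a finite-dimensional space; see \<open>adjoint_wrt_unique\<close> and
  \<open>adjoint_wrt_works\<close> below.\<close>

definition adjoint_wrt :: "('a \<Rightarrow> 'a \<Rightarrow> 'k) \<Rightarrow> ('a \<Rightarrow> 'a) \<Rightarrow> ('a \<Rightarrow> 'a)" where
  "adjoint_wrt g f = (THE h. \<forall>x y. g (f x) y = g x (h y))"

text \<open>The components of \<open>x\<close> in a direct sum of \<open>G 0\<close>, ..., \<open>G (k - 1)\<close>. Component families are
  taken to be \<open>undefined\<close> outside \<open>{..<k}\<close>, which makes them unique as functions.\<close>

definition component :: "nat \<Rightarrow> (nat \<Rightarrow> 'a::comm_monoid_add set) \<Rightarrow> nat \<Rightarrow> 'a \<Rightarrow> 'a" where
  "component k G i x = (THE c. c \<in> (\<Pi>\<^sub>E i\<in>{..<k}. G i) \<and> x = (\<Sum>i<k. c i)) i"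

text \<open>The restriction of \<open>g\<close> to the \<open>i\<close>-th summand, extended by zero on the others.\<close>

definition metric_part ::
    "('a::comm_monoid_add \<Rightarrow> 'a \<Rightarrow> 'k) \<Rightarrow> nat \<Rightarrow> (nat \<Rightarrow> 'a set) \<Rightarrow> nat \<Rightarrow> 'a \<Rightarrow> 'a \<Rightarrow> 'k" where
  "metric_part g k G i x y = g (component k G i x) (component k G i y)"

locale lie_algebra = vector_space scale
  for scale :: "'k::field \<Rightarrow> 'a::ab_group_add \<Rightarrow> 'a" +
  fixes bracket :: "'a \<Rightarrow> 'a \<Rightarrow> 'a"
  assumes bracket_linear_left: "Vector_Spaces.linear scale scale (\<lambda>x. bracket x y)"
    and bracket_linear_right: "Vector_Spaces.linear scale scale (\<lambda>y. bracket x y)"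
    and bracket_self: "bracket x x = 0"
    and jacobi: "bracket x (bracket y z) + bracket y (bracket z x) + bracket z (bracket x y) = 0"
begin

definition derivation :: "('a \<Rightarrow> 'a) \<Rightarrow> bool" where
  "derivation D \<longleftrightarrow> Vector_Spaces.linear scale scale D \<and>
     (\<forall>x y. D (bracket x y) = bracket (D x) y + bracket x (D y))"

definition automorphism :: "('a \<Rightarrow> 'a) \<Rightarrow> bool" where
  "automorphism \<psi> \<longleftrightarrow> Vector_Spaces.linear scale scale \<psi> \<and> bij \<psi> \<and>
     (\<forall>x y. \<psi> (bracket x y) = bracket (\<psi> x) (\<psi> y))"

definition ad_invariant_map :: "('a \<Rightarrow> 'a) \<Rightarrow> bool" where
  "ad_invariant_map \<phi> \<longleftrightarrow> Vector_Spaces.linear scale scale \<phi> \<and>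
     (\<forall>x y. \<phi> (bracket x y) = bracket x (\<phi> y))"

definition metric :: "('a \<Rightarrow> 'a \<Rightarrow> 'k) \<Rightarrow> bool" where
  "metric g \<longleftrightarrow>
     (\<forall>y. Vector_Spaces.linear scale (*) (\<lambda>x. g x y)) \<and>
     (\<forall>x. Vector_Spaces.linear scale (*) (\<lambda>y. g x y)) \<and>
     (\<forall>x y. g x y = g y x) \<and>
     (\<forall>x. (\<forall>y. g x y = 0) \<longrightarrow> x = 0)"

definition ad_invariant_metric :: "('a \<Rightarrow> 'a \<Rightarrow> 'k) \<Rightarrow> bool" where
  "ad_invariant_metric g \<longleftrightarrow> metric g \<and>
     (\<forall>x y z. g (bracket x y) z = - g y (bracket x z))"

definition solitary :: "('a \<Rightarrow> 'a \<Rightarrow> 'k) \<Rightarrow> bool" where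
  "solitary g \<longleftrightarrow> ad_invariant_metric g \<and>
     (\<forall>\<phi>. ad_invariant_map \<phi> \<and> adjoint_wrt g \<phi> = \<phi> \<longrightarrow>
        (\<exists>D. derivation D \<and> (\<forall>x. \<phi> x = D x + adjoint_wrt g D x)))"

text \<open>The notions below are relative to a carrier \<open>L\<close>, so that reducibility makes sense
  both for the whole Lie algebra (\<open>L = UNIV\<close>) and for an ideal regarded as a Lie algebra in its
  own right.\<close>

definition lie_ideal :: "'a set \<Rightarrow> 'a set \<Rightarrow> bool" where
  "lie_ideal L I \<longleftrightarrow> subspace I \<and> I \<subseteq> L \<and> (\<forall>x\<in>L. \<forall>y\<in>I. bracket x y \<in> I)"

definition reducible :: "'a set \<Rightarrow> bool" where
  "reducible L \<longleftrightarrow> (\<exists>I J. lie_ideal L I \<and> lie_ideal L J \<and> I \<noteq> {0} \<and> J \<noteq> {0} \<and>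
     I \<inter> J = {0} \<and> L = {x + y | x y. x \<in> I \<and> y \<in> J})"

abbreviation irreducible :: "'a set \<Rightarrow> bool" where
  "irreducible L \<equiv> \<not> reducible L"

definition direct_sum :: "nat \<Rightarrow> (nat \<Rightarrow> 'a set) \<Rightarrow> bool" where
  "direct_sum k G \<longleftrightarrow> (\<forall>i<k. subspace (G i)) \<and>
     (\<forall>x. \<exists>!c. c \<in> (\<Pi>\<^sub>E i\<in>{..<k}. G i) \<and> x = (\<Sum>i<k. c i))"

definition irreducible_orthogonal_decomposition ::
    "('a \<Rightarrow> 'a \<Rightarrow> 'k) \<Rightarrow> nat \<Rightarrow> (nat \<Rightarrow> 'a set) \<Rightarrow> bool" where
  "irreducible_orthogonal_decomposition g k G \<longleftrightarrow> direct_sum k G \<and>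
     (\<forall>i<k. lie_ideal UNIV (G i) \<and> irreducible (G i)) \<and>
     (\<forall>i<k. \<forall>j<k. i \<noteq> j \<longrightarrow> (\<forall>x\<in>G i. \<forall>y\<in>G j. g x y = 0))"

lemma component_in:
  assumes "direct_sum k G" and "i < k"
  shows "component k G i x \<in> G i"
proof -
  have "\<exists>!c. c \<in> (\<Pi>\<^sub>E i\<in>{..<k}. G i) \<and> x = (\<Sum>i<k. c i)"
    using assms(1) unfolding direct_sum_def by blast
  from theI'[OF this] show ?thesis
    using assms(2) unfolding component_def by (auto simp: PiE_iff)
qed

lemma sum_component:
  assumes "direct_sum k G"
  shows "(\<Sum>i<k. component k G i x) = x"
proof -
  have "\<exists>!c. c \<in> (\<Pi>\<^sub>E i\<in>{..<k}. G i) \<and> x = (\<Sum>i<k. c i)"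
    using assms unfolding direct_sum_def by blast
  from theI'[OF this] show ?thesis
    unfolding component_def by simp
qed

lemma metric_sum_left:
  assumes "metric g"
  shows "g (\<Sum>i\<in>A. f i) y = (\<Sum>i\<in>A. g (f i) y)"
proof -
  interpret l: Vector_Spaces.linear scale "(*)" "\<lambda>x. g x y"
    using assms unfolding metric_def by blast
  show ?thesis by (rule l.sum)
qed

lemma metric_sum_right:
  assumes "metric g"
  shows "g x (\<Sum>i\<in>A. f i) = (\<Sum>i\<in>A. g x (f i))"
proof -
  interpret l: Vector_Spaces.linear scale "(*)" "\<lambda>y. g x y"
    using assms unfolding metric_def by blast
  show ?thesis by (rule l.sum)
qed

lemma sum_metric_part:
  assumes g: "metric g" and dec: "irreducible_orthogonal_decomposition g k G"
  shows "(\<Sum>i<k. metric_part g k G i x y) = g x y"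
proof -
  let ?c = "component k G"
  have ds: "direct_sum k G"
    using dec unfolding irreducible_orthogonal_decomposition_def by blast
  have "g x y = g (\<Sum>i<k. ?c i x) (\<Sum>j<k. ?c j y)"
    by (simp add: sum_component[OF ds])
  also have "\<dots> = (\<Sum>i<k. \<Sum>j<k. g (?c i x) (?c j y))"
    by (simp only: metric_sum_left[OF g], simp only: metric_sum_right[OF g])
  also have "\<dots> = (\<Sum>i<k. \<Sum>j<k. if i = j then g (?c i x) (?c j y) else 0)"
    using dec component_in[OF ds] unfolding irreducible_orthogonal_decomposition_def
    by (intro sum.cong) auto
  also have "\<dots> = (\<Sum>i<k. metric_part g k G i x y)"
    by (simp add: metric_part_def)
  finally show ?thesis by simp
qed

lemma adjoint_wrt_unique:
  assumes g: "metric g" and h: "\<And>x y. g (f x) y = g x (h y)"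
  shows "adjoint_wrt g f = h"
  unfolding adjoint_wrt_def
proof (rule the_equality)
  show "\<forall>x y. g (f x) y = g x (h y)" using h by blast
next
  fix h' assume h': "\<forall>x y. g (f x) y = g x (h' y)"
  show "h' = h"
  proof
    fix y
    have "g (h' y - h y) x = 0" for x
    proof -
      interpret l: Vector_Spaces.linear scale "(*)" "\<lambda>y. g x y"
        using g unfolding metric_def by blast
      have "g x (h' y - h y) = 0" using h h' by (simp add: l.diff)
      then show ?thesis using g unfolding metric_def by metis
    qed
    then have "h' y - h y = 0" using g unfolding metric_def by blast
    then show "h' y = h y" by simp
  qed
qed

end

locale finite_dim_lie_algebra = lie_algebra +
  assumes finite_dim: "\<exists>B. finite_dimensional_vector_space scale B"
begin

lemma adjoint_wrt_works:
  assumes g: "metric g" and f: "Vector_Spaces.linear scale scale f"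
  shows "g (f x) y = g x (adjoint_wrt g f y)"
proof -
  obtain B where "finite_dimensional_vector_space scale B" using finite_dim by blast
  then interpret B: finite_dimensional_vector_space scale B .
  have indep: "u b = 0" if "(\<Sum>b\<in>B. scale (u b) b) = 0" "b \<in> B" for u b
    using B.independent_Basis that unfolding dependent_finite[OF B.finite_Basis] by blast
  let ?T = "\<lambda>y. \<Sum>b\<in>B. scale (g b y) b"
  have gl: "Vector_Spaces.linear scale (*) (\<lambda>x. g x y)" for y
    using g unfolding metric_def by blast
  have gr: "Vector_Spaces.linear scale (*) (g x)" for x
    using g unfolding metric_def by blast
  interpret vp: vector_space_pair scale "(*)"
    using vector_space_axioms Vector_Spaces.linear.axioms(2)[OF gl] by (rule vector_space_pair.intro)
  interpret ss: vector_space_pair scale scale by unfold_locales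
  have gadd: "g x (y + z) = g x y + g x z" for x y z
    using gr[of x] by (simp add: Vector_Spaces.linear_iff)
  have gscale: "g x (scale c z) = c * g x z" for x c z
    using gr[of x] by (simp add: Vector_Spaces.linear_iff)
  have "Vector_Spaces.linear scale scale ?T"
    unfolding Vector_Spaces.linear_iff using vector_space_axioms
    by (simp add: gadd gscale scale_left_distrib sum.distrib scale_sum_right)
  moreover have "inj ?T"
    unfolding ss.linear_inj_iff_eq_0[OF calculation]
  proof (intro allI impI)
    fix y assume "?T y = 0"
    then have z: "g b y = 0" if "b \<in> B" for b
      using indep[of "\<lambda>b. g b y"] that by blast
    have "g x y = 0" for x
      using vp.linear_eq_0_on_span[OF gl z, of B] B.span_Basis by auto
    then show "y = 0" using g unfolding metric_def by metis
  qed
  ultimately have "surj ?T" by (rule B.linear_inj_imp_surj)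
  have ex: "\<exists>z. \<forall>x. g (f x) y = g x z" for y
  proof -
    obtain z where z: "(\<Sum>b\<in>B. scale (g (f b) y) b) = ?T z"
      using surjD[OF \<open>surj ?T\<close>, of "\<Sum>b\<in>B. scale (g (f b) y) b"] by blast
    have "(\<Sum>b\<in>B. scale (g (f b) y - g b z) b) = 0"
      using z by (simp only: scale_left_diff_distrib sum_subtractf right_minus_eq)
    then have eq: "g (f b) y - g b z = 0" if "b \<in> B" for b
      using indep[of "\<lambda>b. g (f b) y - g b z"] that by blast
    have lin: "Vector_Spaces.linear scale (*) (\<lambda>x. g (f x) y - g x z)"
      using gl[of y] gl[of z] f by (simp add: Vector_Spaces.linear_iff algebra_simps)
    have "g (f x) y - g x z = 0" for x
      using vp.linear_eq_0_on_span[OF lin eq, of B] B.span_Basis by auto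
    then show ?thesis by auto
  qed
  then obtain h where h: "\<And>x y. g (f x) y = g x (h y)" by metis
  show ?thesis using adjoint_wrt_unique[of g f h, OF g h] h[of x y] by simp
qed

end

end

(* Ad-invariant metrics are the forms g(\<phi> \<cdot>, \<cdot>) with \<phi> in the space A of ad-invariant self-adjoint
   maps, \<phi> invertible. Since \<phi> D is a derivation for every derivation D, the tangent space to the
   Aut-orbit of g(\<phi> \<cdot>, \<cdot>) is {F + F* | F derivation}, independently of \<phi>; g is solitary iff this is
   all of A.

   If g is solitary, then a short linear path \<phi> + t \<beta> of forms, with \<beta> = F + F*, is the pullback of
   the first form under the flow of the derivations (\<phi> + t \<beta>)^-1 F. So forms joined by a segment of
   nondegenerate forms are isometric. Over \<complex>, \<phi> is joined to the identity through a suitable multiple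
   of the identity. Over \<real>, let P be the projection to an irreducible ideal: P \<phi>^-1 P cannot have both
   positive and negative eigenvalues there, so one of \<phi> + t P, \<phi> - t P is invertible for all t >= 0.
   Moving far in such a direction for each summand makes \<phi> comparable to a signed sum of projections.

   Conversely, the pigeonhole principle gives for each \<phi> an automorphism that scales g(\<phi> \<cdot>, \<cdot>) by a
   factor c > 1. The map that multiplies its generalized \<mu>-eigenspace by ln |\<mu>| is a derivation that
   scales g(\<phi> \<cdot>, \<cdot>) infinitesimally by ln c, so \<phi> = F + F* for a derivation F. As A is spanned by
   its invertible elements, g is solitary. *)

theory Submission
  imports Defs "HOL-Computational_Algebra.Fundamental_Theorem_Algebra" "HOL-Library.Product_Plus"
begin

section \<open>Polynomials in a linear map\<close>

text \<open>For the converse direction only the finiteness of the number of isometry classes is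
  used, so one argument covers all three cases. The automorphism that it yields need not lie on a
  one-parameter group, so it may have no logarithm among the derivations. Discarding the arguments
  of its eigenvalues removes the problem: ln |.| is single-valued, turns products of nonzero numbers
  into sums and is invariant under conjugation. The resulting map respects every bilinear map that
  the automorphism respects, and it has a real form. In the forward direction the inverse of \<phi>
  + t \<beta> is a geometric series, so the path of derivations has explicit coefficients. The flow
  is then built and checked by recursion on coefficients. Over the reals the obstacle is that \<phi>
  need not map the ideals of the decomposition to themselves. This is why its inverse is compressed
  to a summand, and why the signs are found one after another, each for the map already displaced in
  the earlier directions. A whole ray of nonsingular maps is needed, because the displacement must
  finally dominate \<phi> in norm.\<close>

lemma hom_add: "Vector_Spaces.linear s1 s2 f \<Longrightarrow> f (x + y) = f x + f y"
  and hom_scale: "Vector_Spaces.linear s1 s2 f \<Longrightarrow> f (s1 c x) = s2 c (f x)"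
  by (simp_all add: Vector_Spaces.linear_iff)

lemma hom_zero: "Vector_Spaces.linear s1 s2 f \<Longrightarrow> f 0 = 0"
  by (metis hom_add add.right_neutral add_left_cancel)

lemma hom_diff:
  assumes "Vector_Spaces.linear s1 s2 f"
  shows "f (x - y) = f x - f y"
  using hom_add[OF assms, of "x - y" y] by (simp add: algebra_simps)

lemma hom_uminus:
  assumes "Vector_Spaces.linear s1 s2 f"
  shows "f (- x) = - f x"
  using hom_diff[OF assms, of 0 x] by (simp add: hom_zero[OF assms])

lemma hom_sum:
  assumes "Vector_Spaces.linear s1 s2 f"
  shows "f (sum u A) = (\<Sum>a\<in>A. f (u a))"
  by (induction A rule: infinite_finite_induct) (simp_all add: hom_zero[OF assms] hom_add[OF assms])

lemmas hom_simps = hom_add hom_scale hom_zero hom_diff hom_uminus hom_sum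

locale field_space = vector_space scale
  for scale :: "'a::field \<Rightarrow> 'b::ab_group_add \<Rightarrow> 'b"
begin

abbreviation lin :: "('b \<Rightarrow> 'b) \<Rightarrow> bool" where
  "lin \<equiv> Vector_Spaces.linear scale scale"

lemma linI:
  assumes "\<And>x y. f (x + y) = f x + f y" and "\<And>c x. f (scale c x) = scale c (f x)"
  shows "lin f"
  using assms vector_space_axioms by (simp add: Vector_Spaces.linear_iff)

lemma lin_id: "lin (\<lambda>x. x)"
  by (rule linI) simp_all

lemma lin_comp: "lin f \<Longrightarrow> lin h \<Longrightarrow> lin (\<lambda>x. f (h x))"
  by (rule linI) (simp_all add: hom_simps)

lemma lin_add: "lin f \<Longrightarrow> lin h \<Longrightarrow> lin (\<lambda>x. f x + h x)"
  by (rule linI) (simp_all add: hom_simps algebra_simps scale_right_distrib)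

lemma lin_diff: "lin f \<Longrightarrow> lin h \<Longrightarrow> lin (\<lambda>x. f x - h x)"
  by (rule linI) (simp_all add: hom_simps algebra_simps scale_right_diff_distrib)

lemma lin_scale: "lin f \<Longrightarrow> lin (\<lambda>x. scale c (f x))"
  by (rule linI) (simp_all add: hom_simps scale_right_distrib mult.commute)

lemma lin_sum: "(\<And>i. i \<in> I \<Longrightarrow> lin (f i)) \<Longrightarrow> lin (\<lambda>x. \<Sum>i\<in>I. f i x)"
  by (induction I rule: infinite_finite_induct)
    (simp_all add: lin_add linI)

lemma lin_funpow: "lin f \<Longrightarrow> lin (f ^^ n)"
  by (induction n) (auto simp: id_def comp_def intro: lin_id lin_comp)

definition poly_map :: "'a poly \<Rightarrow> ('b \<Rightarrow> 'b) \<Rightarrow> 'b \<Rightarrow> 'b" where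
  "poly_map p f x = (\<Sum>i\<le>degree p. scale (coeff p i) ((f ^^ i) x))"

lemma poly_map_0 [simp]: "poly_map 0 f x = 0"
  by (simp add: poly_map_def)

lemma poly_map_pCons:
  assumes "lin f"
  shows "poly_map (pCons c p) f x = scale c x + f (poly_map p f x)"
proof (cases "p = 0")
  case True
  then show ?thesis by (simp add: poly_map_def hom_zero[OF assms])
next
  case False
  then show ?thesis
    by (simp add: poly_map_def sum.atMost_Suc_shift hom_simps[OF assms] del: sum.atMost_Suc)
qed

lemma lin_poly_map: "lin f \<Longrightarrow> lin (poly_map p f)"
  unfolding poly_map_def by (intro lin_sum lin_scale lin_funpow)

lemma poly_map_add: "lin f \<Longrightarrow> poly_map (p + q) f x = poly_map p f x + poly_map q f x"
  by (induction p q rule: poly_induct2)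
    (simp_all add: poly_map_pCons hom_simps scale_left_distrib algebra_simps)

lemma poly_map_smult: "lin f \<Longrightarrow> poly_map (smult c p) f x = scale c (poly_map p f x)"
  by (induction p) (simp_all add: poly_map_pCons hom_simps scale_right_distrib)

lemma poly_map_mult: "lin f \<Longrightarrow> poly_map (p * q) f x = poly_map p f (poly_map q f x)"
  by (induction p) (simp_all add: poly_map_pCons poly_map_add poly_map_smult hom_simps)

lemma poly_map_1: "lin f \<Longrightarrow> poly_map 1 f x = x"
  by (simp add: one_pCons poly_map_pCons hom_zero)

lemma poly_map_commute: "lin f \<Longrightarrow> poly_map p f (poly_map q f x) = poly_map q f (poly_map p f x)"
  by (metis poly_map_mult mult.commute)

section \<open>Generalized eigenvectors and interpolation on them\<close>

definition shift :: "('b \<Rightarrow> 'b) \<Rightarrow> 'a \<Rightarrow> 'b \<Rightarrow> 'b" where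
  "shift f \<mu> x = f x - scale \<mu> x"

lemma lin_shift: "lin f \<Longrightarrow> lin (shift f \<mu>)"
  unfolding shift_def by (intro lin_diff lin_scale lin_id)

lemma poly_map_linear_power:
  "lin f \<Longrightarrow> poly_map ([:- \<mu>, 1:] ^ n) f x = (shift f \<mu> ^^ n) x"
  by (induction n)
    (simp_all add: poly_map_1 poly_map_mult poly_map_pCons hom_zero shift_def algebra_simps
      del: mult_pCons_left)

text \<open>Generalized eigenvectors; the zero vector is one for every \<open>\<mu>\<close>.\<close>

definition gen_eigen :: "('b \<Rightarrow> 'b) \<Rightarrow> 'a \<Rightarrow> 'b set" where
  "gen_eigen f \<mu> = {x. \<exists>n. (shift f \<mu> ^^ n) x = 0}"

lemma gen_eigen_iff:
  "lin f \<Longrightarrow> x \<in> gen_eigen f \<mu> \<longleftrightarrow> (\<exists>n. poly_map ([:- \<mu>, 1:] ^ n) f x = 0)"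
  by (simp add: gen_eigen_def poly_map_linear_power)

lemma gen_eigen_poly_map: "lin f \<Longrightarrow> x \<in> gen_eigen f \<mu> \<Longrightarrow> poly_map p f x \<in> gen_eigen f \<mu>"
  by (metis gen_eigen_iff poly_map_commute hom_zero lin_poly_map)

end

text \<open>Since q - q(\<mu>) is a multiple of X - \<mu>, a constant multiple of q is 1 modulo X -
  \<mu>. Multiplying this identity into the one for the n-th power gives the next power.\<close>

lemma linear_power_bezout:
  fixes q :: "'k::field poly"
  assumes "poly q \<mu> \<noteq> 0"
  obtains a b where "a * [:- \<mu>, 1:] ^ n + b * q = 1"
proof -
  have "\<exists>a b. a * [:- \<mu>, 1:] ^ n + b * q = 1"
  proof (induction n)
    case 0
    show ?case by (rule exI[of _ 1], rule exI[of _ 0]) simp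
  next
    case (Suc n)
    let ?X = "[:- \<mu>, 1:]"
    obtain a b where ab: "a * ?X ^ n + b * q = 1" using Suc by blast
    define c where "c = poly q \<mu>"
    have "poly (q - [:c:]) \<mu> = 0" by (simp add: c_def)
    then obtain s where "q - [:c:] = ?X * s" unfolding poly_eq_0_iff_dvd by (auto elim: dvdE)
    then have q: "q = ?X * s + [:c:]" by (simp add: algebra_simps)
    have c: "[:inverse c:] * [:c:] = 1" using assms by (simp add: c_def one_pCons)
    define u v where "u = - [:inverse c:] * s" and "v = [:inverse c:]"
    have "u * ?X + v * q = [:inverse c:] * [:c:]" unfolding u_def v_def q by algebra
    then have uv: "u * ?X + v * q = 1" using c by simp
    have "(a * u) * ?X ^ Suc n + (a * ?X ^ n * v + b) * q = a * ?X ^ n * (u * ?X + v * q) + b * q"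
      unfolding power_Suc by algebra
    also have "\<dots> = 1" using ab uv by simp
    finally show ?case by blast
  qed
  then show ?thesis using that by blast
qed

context field_space
begin

text \<open>Both terms of the Bezout identity for (X - \<mu>)^n and q annihilate x, while their sum
  acts as the identity.\<close>

lemma gen_eigen_coprime:
  assumes f: "lin f" and q: "poly q \<mu> \<noteq> 0"
    and x: "x \<in> gen_eigen f \<mu>" and 0: "poly_map q f x = 0"
  shows "x = 0"
proof -
  obtain n where n: "poly_map ([:- \<mu>, 1:] ^ n) f x = 0" using x gen_eigen_iff[OF f] by blast
  obtain a b where "a * [:- \<mu>, 1:] ^ n + b * q = 1" using linear_power_bezout[OF q] .
  then have "x = poly_map (a * [:- \<mu>, 1:] ^ n + b * q) f x" by (simp add: poly_map_1[OF f])
  also have "\<dots> = 0"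
    by (simp add: poly_map_add[OF f] poly_map_mult[OF f] n 0 hom_zero[OF lin_poly_map[OF f]])
  finally show ?thesis .
qed

text \<open>Ensures that for an automorphism ln |\<mu>| is needed only at nonzero \<mu>.\<close>

lemma gen_eigen_zero_of_inj:
  assumes f: "lin f" and "inj f" and x: "x \<in> gen_eigen f 0"
  shows "x = 0"
proof -
  have "shift f 0 = f" by (simp add: shift_def fun_eq_iff)
  then obtain n where "(f ^^ n) x = 0" using x by (auto simp: gen_eigen_def)
  then show ?thesis
  proof (induction n)
    case (Suc n)
    have "f ((f ^^ n) x) = f 0" using Suc.prems hom_zero[OF f] by simp
    then show ?case using Suc.IH \<open>inj f\<close> by (simp add: inj_eq)
  qed simp
qed

end

text \<open>The interpolating polynomial is built by splitting off one root at a time.\<close>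

lemma gen_eigen_interpolation:
  fixes scale :: "complex \<Rightarrow> 'a::ab_group_add \<Rightarrow> 'a" and p :: "complex poly"
  assumes "vector_space scale" and f: "Vector_Spaces.linear scale scale f" and "p \<noteq> 0"
  shows "\<exists>r. \<forall>x \<mu>. field_space.poly_map scale p f x = 0 \<longrightarrow> x \<in> field_space.gen_eigen scale f \<mu>
           \<longrightarrow> field_space.poly_map scale r f x = scale (h \<mu>) x"
    and "\<forall>x. field_space.poly_map scale p f x = 0
           \<longrightarrow> x \<in> module.span scale (\<Union>\<mu>. field_space.gen_eigen scale f \<mu>)"
proof -
  interpret field_space scale using assms(1) by (rule field_space.intro)
  let ?E = "\<Union>\<mu>. gen_eigen f \<mu>"
  have "(\<exists>r. \<forall>x \<mu>. poly_map p f x = 0 \<longrightarrow> x \<in> gen_eigen f \<mu> \<longrightarrow> poly_map r f x = scale (h \<mu>) x)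
        \<and> (\<forall>x. poly_map p f x = 0 \<longrightarrow> x \<in> span ?E)"
    using \<open>p \<noteq> 0\<close>
  proof (induction "degree p" arbitrary: p rule: less_induct)
    case less
    show ?case
    proof (cases "degree p = 0")
      case True
      then obtain c where p: "p = [:c:]" by (metis degree_eq_zeroE)
      with less.prems have "c \<noteq> 0" by simp
      then have "x = 0" if "poly_map p f x = 0" for x
        using that by (simp add: p poly_map_pCons[OF f] hom_zero[OF f])
      then show ?thesis by (metis poly_map_0 scale_zero_right span_zero)
    next
      case False
      then have "\<not> constant (poly p)" by (simp add: constant_degree)
      then obtain \<mu> where \<mu>: "poly p \<mu> = 0" using fundamental_theorem_of_algebra by blast
      let ?X = "[:- \<mu>, 1:]"
      have "order \<mu> p \<noteq> 0" using \<mu> less.prems by (simp add: order_root)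
      then obtain m q where m: "m \<noteq> 0" and p: "p = ?X ^ m * q" and "\<not> ?X dvd q"
        using order_decomp[OF less.prems] by blast
      then have q: "poly q \<mu> \<noteq> 0" by (simp add: poly_eq_0_iff_dvd)
      then have "q \<noteq> 0" by auto
      have "degree (?X ^ m * q) = m + degree q"
        using \<open>q \<noteq> 0\<close> by (simp add: degree_mult_eq degree_linear_power)
      then have "degree q < degree p" using m p by simp
      from less.hyps[OF this \<open>q \<noteq> 0\<close>] obtain r where
        r: "\<And>x \<nu>. poly_map q f x = 0 \<Longrightarrow> x \<in> gen_eigen f \<nu> \<Longrightarrow> poly_map r f x = scale (h \<nu>) x"
        and sp: "\<And>x. poly_map q f x = 0 \<Longrightarrow> x \<in> span ?E" by blast
      \<comment> \<open>On the kernel of \<open>p\<close> the two summands act as complementary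
        projections: \<open>?a\<close> onto the kernel of \<open>q\<close>, \<open>?b\<close> onto
        the kernel of \<open>?X ^ m\<close>.\<close>
      obtain a b where ab: "a * ?X ^ m + b * q = 1" using linear_power_bezout[OF q] .
      let ?a = "a * ?X ^ m" and ?b = "b * q"
      note pm = poly_map_add[OF f] poly_map_mult[OF f] poly_map_smult[OF f]
        hom_zero[OF lin_poly_map[OF f]]
      have 1: "poly_map q f (poly_map ?a f x) = 0" "poly_map (?X ^ m) f (poly_map ?b f x) = 0"
        "poly_map ?a f x + poly_map ?b f x = x" if x: "poly_map p f x = 0" for x
      proof -
        have "q * ?a = a * p" "?X ^ m * ?b = b * p"
          unfolding p by (simp_all only: mult.assoc mult.commute mult.left_commute)
        then show "poly_map q f (poly_map ?a f x) = 0" "poly_map (?X ^ m) f (poly_map ?b f x) = 0"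
          using x pm by metis+
        show "poly_map ?a f x + poly_map ?b f x = x"
          using ab poly_map_1[OF f] poly_map_add[OF f] by metis
      qed
      \<comment> \<open>The interpolating polynomial follows \<open>r\<close> on the kernel of
        \<open>q\<close> and is the constant \<open>h \<mu>\<close> on the part belonging to the
        root split off.\<close>
      have "poly_map (r * ?a + smult (h \<mu>) ?b) f x = scale (h \<nu>) x"
        if x: "poly_map p f x = 0" and e: "x \<in> gen_eigen f \<nu>" for x \<nu>
      proof -
        let ?x1 = "poly_map ?a f x" and ?x2 = "poly_map ?b f x"
        have "poly_map r f ?x1 = scale (h \<nu>) ?x1"
          using r 1(1)[OF x] gen_eigen_poly_map[OF f e] by blast
        \<comment> \<open>If \<mu> and \<nu> differ, \<open>?x2\<close> is a generalized eigenvector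
          for \<nu> annihilated by a power of X - \<mu>, hence zero.\<close>
        moreover have "scale (h \<mu>) ?x2 = scale (h \<nu>) ?x2"
        proof (cases "\<mu> = \<nu>")
          case False
          then have "poly (?X ^ m) \<nu> \<noteq> 0" by (simp add: poly_power)
          then have "?x2 = 0"
            using gen_eigen_coprime[OF f _ gen_eigen_poly_map[OF f e] 1(2)[OF x]] by blast
          then show ?thesis by simp
        qed simp
        ultimately have "poly_map (r * ?a + smult (h \<mu>) ?b) f x = scale (h \<nu>) (?x1 + ?x2)"
          by (simp only: poly_map_add[OF f] poly_map_mult[OF f, of r] poly_map_smult[OF f]
              scale_right_distrib)
        then show ?thesis using 1(3)[OF x] by simp
      qed
      moreover have "x \<in> span ?E" if x: "poly_map p f x = 0" for x
      proof -
        have "poly_map ?b f x \<in> ?E" using 1(2)[OF x] gen_eigen_iff[OF f] by blast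
        then show ?thesis using sp[OF 1(1)[OF x]] 1(3)[OF x] span_add span_base by metis
      qed
      ultimately show ?thesis by blast
    qed
  qed
  then show "\<exists>r. \<forall>x \<mu>. poly_map p f x = 0 \<longrightarrow> x \<in> gen_eigen f \<mu> \<longrightarrow> poly_map r f x = scale (h \<mu>) x"
    and "\<forall>x. poly_map p f x = 0 \<longrightarrow> x \<in> span ?E" by blast+
qed

section \<open>Derivations from automorphisms\<close>

text \<open>The scaling of the target is a separate parameter so that the bracket, scalar-valued
  forms and their complexifications fall under the same lemmas.\<close>

definition bilin :: "('k \<Rightarrow> 'a \<Rightarrow> 'a) \<Rightarrow> ('k::field \<Rightarrow> 'c \<Rightarrow> 'c) \<Rightarrow> ('a::ab_group_add \<Rightarrow> 'a \<Rightarrow> 'c::ab_group_add) \<Rightarrow> bool"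
  where "bilin s1 s2 \<beta> \<longleftrightarrow> (\<forall>y. Vector_Spaces.linear s1 s2 (\<lambda>x. \<beta> x y)) \<and>
           (\<forall>x. Vector_Spaces.linear s1 s2 (\<beta> x))"

lemma bilin_left: "bilin s1 s2 \<beta> \<Longrightarrow> Vector_Spaces.linear s1 s2 (\<lambda>x. \<beta> x y)"
  and bilin_right: "bilin s1 s2 \<beta> \<Longrightarrow> Vector_Spaces.linear s1 s2 (\<beta> x)"
  by (simp_all add: bilin_def)

lemmas bilin_simps = hom_simps[OF bilin_left] hom_simps[OF bilin_right]

lemma bilin_target: "bilin s1 s2 \<beta> \<Longrightarrow> vector_space s2"
  by (auto simp: bilin_def Vector_Spaces.linear_iff)

lemma vector_space_mult: "vector_space ((*) :: 'k::field \<Rightarrow> 'k \<Rightarrow> 'k)"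
  by unfold_locales (simp_all add: algebra_simps)

lemma bilin_add:
  assumes "bilin s1 s2 \<beta>" "bilin s1 s2 \<gamma>"
  shows "bilin s1 s2 (\<lambda>x y. \<beta> x y + \<gamma> x y)"
proof -
  interpret vector_space s2 using bilin_target[OF assms(1)] .
  show ?thesis using assms
    by (simp add: bilin_def Vector_Spaces.linear_iff scale_right_distrib algebra_simps)
qed

lemma bilin_diff:
  assumes "bilin s1 s2 \<beta>" "bilin s1 s2 \<gamma>"
  shows "bilin s1 s2 (\<lambda>x y. \<beta> x y - \<gamma> x y)"
proof -
  interpret vector_space s2 using bilin_target[OF assms(1)] .
  show ?thesis using assms
    by (simp add: bilin_def Vector_Spaces.linear_iff scale_right_diff_distrib algebra_simps)
qed

lemma bilin_scale: "bilin s1 s2 \<beta> \<Longrightarrow> bilin s1 s2 (\<lambda>x y. s2 c (\<beta> x y))"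
  by (simp add: bilin_def Vector_Spaces.linear_iff vector_space.vector_space_assms mult.commute)

lemma bilin_comp_left: "bilin s1 s2 \<beta> \<Longrightarrow> Vector_Spaces.linear s1 s1 D \<Longrightarrow> bilin s1 s2 (\<lambda>x y. \<beta> (D x) y)"
  and bilin_comp_right: "bilin s1 s2 \<beta> \<Longrightarrow> Vector_Spaces.linear s1 s1 D \<Longrightarrow> bilin s1 s2 (\<lambda>x y. \<beta> x (D y))"
  and bilin_comp: "bilin s1 s2 \<beta> \<Longrightarrow> Vector_Spaces.linear s2 s2 t \<Longrightarrow> bilin s1 s2 (\<lambda>x y. t (\<beta> x y))"
  by (simp_all add: bilin_def Vector_Spaces.linear_iff)

text \<open>Subtracting \<mu> \<nu> from t gives (t - \<mu> \<nu>) \<beta>(x, y) = \<beta>((f -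
  \<mu>) x, f y) + \<mu> \<beta>(x, (f - \<nu>) y). Each term lowers one of the two nilpotency
  exponents, and passing from y to f y does not raise the other because f commutes with f - \<nu>.
  So induction on m + n applies.\<close>

lemma gen_eigen_bilin:
  assumes "vector_space s1" and \<beta>: "bilin s1 s2 \<beta>"
    and f: "Vector_Spaces.linear s1 s1 f" and t: "Vector_Spaces.linear s2 s2 t"
    and tf: "\<And>x y. t (\<beta> x y) = \<beta> (f x) (f y)"
    and x: "(field_space.shift s1 f \<mu> ^^ m) x = 0" and y: "(field_space.shift s1 f \<nu> ^^ n) y = 0"
  shows "(field_space.shift s2 t (\<mu> * \<nu>) ^^ (m + n)) (\<beta> x y) = 0"
proof -
  interpret V: field_space s1 using assms(1) by (rule field_space.intro)
  interpret W: field_space s2 using bilin_target[OF \<beta>] by (rule field_space.intro)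
  let ?t = "W.shift t (\<mu> * \<nu>)" and ?f = "V.shift f \<mu>" and ?g = "V.shift f \<nu>"
  note simps = bilin_simps[OF \<beta>]
  have tp: "W.lin (?t ^^ k)" for k by (intro W.lin_funpow W.lin_shift t)
  have step: "?t (\<beta> x y) = \<beta> (?f x) (f y) + s2 \<mu> (\<beta> x (?g y))" for x y
    by (simp add: W.shift_def V.shift_def tf simps W.scale_right_diff_distrib)
  have comm: "(?g ^^ k) (f y) = f ((?g ^^ k) y)" for k y
    by (induction k) (simp_all add: V.shift_def hom_simps[OF f])
  show ?thesis using x y
  proof (induction "m + n" arbitrary: m n x y)
    case 0
    then show ?case by (simp add: simps)
  next
    case (Suc k)
    show ?case
    proof (cases "m = 0 \<or> n = 0")
      case True
      then have "\<beta> x y = 0" using Suc.prems by (auto simp: simps)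
      then show ?thesis by (simp add: hom_zero[OF tp])
    next
      case False
      then obtain m' n' where m: "m = Suc m'" and n: "n = Suc n'" by (metis not0_implies_Suc)
      have 1: "(?t ^^ (m' + n)) (\<beta> (?f x) (f y)) = 0"
        using Suc.prems Suc.hyps(2)
        by (intro Suc.hyps(1)) (simp_all add: m funpow_swap1 comm hom_zero[OF f] del: funpow.simps(2) add: funpow_Suc_right)
      have 2: "(?t ^^ (m + n')) (\<beta> x (?g y)) = 0"
        using Suc.prems Suc.hyps(2)
        by (intro Suc.hyps(1)) (simp_all add: n funpow_swap1 del: funpow.simps(2) add: funpow_Suc_right)
      have "(?t ^^ (m + n)) (\<beta> x y) = (?t ^^ k) (?t (\<beta> x y))"
        by (simp only: Suc.hyps(2)[symmetric] funpow_Suc_right comp_apply)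
      also have "\<dots> = (?t ^^ k) (\<beta> (?f x) (f y)) + s2 \<mu> ((?t ^^ k) (\<beta> x (?g y)))"
        by (simp add: step hom_simps[OF tp])
      also have "\<dots> = 0"
        using 1 2 Suc.hyps(2) by (simp add: m n)
      finally show ?thesis .
    qed
  qed
qed

lemma bilin_zero_on_span:
  assumes "vector_space s1" and \<beta>: "bilin s1 s2 \<beta>"
    and E: "\<And>x. x \<in> module.span s1 E" and 0: "\<And>x y. x \<in> E \<Longrightarrow> y \<in> E \<Longrightarrow> \<beta> x y = 0"
  shows "\<beta> x y = 0"
proof -
  interpret V: vector_space s1 by fact
  interpret W: vector_space s2 using bilin_target[OF \<beta>] .
  note simps = bilin_simps[OF \<beta>]
  have 1: "\<beta> x y = 0" if "y \<in> E" for x y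
    using E[of x]
  proof (induction rule: V.span_induct)
    case base
    show ?case by (simp add: V.subspace_def simps)
  qed (use 0 that in auto)
  show ?thesis
    using E[of y]
  proof (induction rule: V.span_induct)
    case base
    show ?case by (simp add: V.subspace_def simps)
  qed (use 1 in auto)
qed

text \<open>Here \<open>D\<close> acts as the logarithm of \<open>f\<close> with the arguments of
  the eigenvalues forgotten. Quantifying over all \<beta> makes one and the same \<open>D\<close>
  serve twice: with the bracket it is a derivation, with an invariant form it is an infinitesimal
  homothety of factor \<open>l c\<close>.\<close>

definition log_derivation ::
    "('k::field \<Rightarrow> 'a::ab_group_add \<Rightarrow> 'a) \<Rightarrow> ('a \<Rightarrow> 'a) \<Rightarrow> ('k \<Rightarrow> 'k) \<Rightarrow> ('a \<Rightarrow> 'a) \<Rightarrow> bool" where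
  "log_derivation scale f l D \<longleftrightarrow> Vector_Spaces.linear scale scale D \<and>
     (\<forall>\<beta>. bilin scale scale \<beta> \<longrightarrow> (\<forall>x y. f (\<beta> x y) = \<beta> (f x) (f y)) \<longrightarrow>
        (\<forall>x y. D (\<beta> x y) = \<beta> (D x) y + \<beta> x (D y))) \<and>
     (\<forall>\<beta> c. bilin scale (*) \<beta> \<longrightarrow> (\<forall>x y. \<beta> (f x) (f y) = c * \<beta> x y) \<longrightarrow>
        (\<forall>x y. \<beta> (D x) y + \<beta> x (D y) = l c * \<beta> x y))"

text \<open>On generalized eigenvectors for \<open>\<mu>\<close> the map \<open>D\<close> is multiplication by \<open>ln \<bar>\<mu>\<bar>\<close>.\<close>

lemma log_modulus_complex:
  fixes scale :: "complex \<Rightarrow> 'a::ab_group_add \<Rightarrow> 'a"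
  assumes "vector_space scale" and f: "Vector_Spaces.linear scale scale f" and inj: "inj f"
    and "p \<noteq> 0" and p: "\<And>x. field_space.poly_map scale p f x = 0"
  shows "\<exists>D. log_derivation scale f (\<lambda>c. of_real (ln (cmod c))) D"
proof -
  interpret field_space scale using assms(1) by (rule field_space.intro)
  \<comment> \<open>Not interpreted: the simp rules of \<open>vector_space (*)\<close> loop with associativity.\<close>
  have C: "field_space ((*) :: complex \<Rightarrow> complex \<Rightarrow> complex)"
    using vector_space_mult by (rule field_space.intro)
  define h where "h \<mu> = complex_of_real (ln (cmod \<mu>))" for \<mu>
  let ?E = "\<Union>\<mu>. gen_eigen f \<mu>"
  note interp = gen_eigen_interpolation[OF assms(1) f \<open>p \<noteq> 0\<close>]
  obtain r where r: "\<And>x \<mu>. x \<in> gen_eigen f \<mu> \<Longrightarrow> poly_map r f x = scale (h \<mu>) x"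
    using interp(1)[of h] p by blast
  have sp: "x \<in> span ?E" for x using interp(2) p by blast
  define D where "D = poly_map r f"
  have D: "lin D" unfolding D_def by (rule lin_poly_map[OF f])
  have Dh: "D x = scale (h \<mu>) x" if "x \<in> gen_eigen f \<mu>" for x \<mu>
    using r that by (simp add: D_def)
  \<comment> \<open>Additivity would fail at eigenvalue 0; the nonzero generalized eigenvectors of
    the injective \<open>f\<close> exclude it.\<close>
  have hmult: "h (\<mu> * \<nu>) = h \<mu> + h \<nu>"
    if "x \<in> gen_eigen f \<mu>" "y \<in> gen_eigen f \<nu>" "x \<noteq> 0" "y \<noteq> 0" for x y \<mu> \<nu>
  proof -
    have "\<mu> \<noteq> 0" "\<nu> \<noteq> 0" using that gen_eigen_zero_of_inj[OF f inj] by auto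
    then show ?thesis by (simp add: h_def norm_mult ln_mult)
  qed
  have 1: "D (\<beta> x y) = \<beta> (D x) y + \<beta> x (D y)"
    if \<beta>: "bilin scale scale \<beta>" and f\<beta>: "\<And>x y. f (\<beta> x y) = \<beta> (f x) (f y)" for \<beta> x y
  proof -
    note simps = bilin_simps[OF \<beta>] hom_simps[OF D]
    have "bilin scale scale (\<lambda>x y. D (\<beta> x y) - (\<beta> (D x) y + \<beta> x (D y)))"
      by (rule bilin_diff[OF bilin_comp[OF \<beta> D]
            bilin_add[OF bilin_comp_left[OF \<beta> D] bilin_comp_right[OF \<beta> D]]])
    moreover have "D (\<beta> x y) - (\<beta> (D x) y + \<beta> x (D y)) = 0" if "x \<in> ?E" "y \<in> ?E" for x y
    proof -
      from that obtain \<mu> \<nu> where x: "x \<in> gen_eigen f \<mu>" and y: "y \<in> gen_eigen f \<nu>" by blast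
      then have xy: "\<beta> x y \<in> gen_eigen f (\<mu> * \<nu>)"
        using gen_eigen_bilin[OF assms(1) \<beta> f f f\<beta>] unfolding gen_eigen_def by blast
      have "D (\<beta> x y) - (\<beta> (D x) y + \<beta> x (D y)) = scale (h (\<mu> * \<nu>) - (h \<mu> + h \<nu>)) (\<beta> x y)"
        by (simp add: Dh[OF x] Dh[OF y] Dh[OF xy] bilin_simps[OF \<beta>] scale_left_distrib scale_left_diff_distrib)
      also have "\<dots> = 0"
        using hmult[OF x y] by (cases "x = 0 \<or> y = 0") (auto simp: simps)
      finally show ?thesis .
    qed
    ultimately have "D (\<beta> x y) - (\<beta> (D x) y + \<beta> x (D y)) = 0"
      by (rule bilin_zero_on_span[OF assms(1) _ sp])
    then show ?thesis by simp
  qed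
  have 2: "\<beta> (D x) y + \<beta> x (D y) = of_real (ln (cmod c)) * \<beta> x y"
    if \<beta>: "bilin scale (*) \<beta>" and f\<beta>: "\<And>x y. \<beta> (f x) (f y) = c * \<beta> x y" for \<beta> c x y
  proof -
    note simps = bilin_simps[OF \<beta>] hom_simps[OF D]
    have "bilin scale (*) (\<lambda>x y. (\<beta> (D x) y + \<beta> x (D y)) - h c * \<beta> x y)"
      by (rule bilin_diff[OF bilin_add[OF bilin_comp_left[OF \<beta> D] bilin_comp_right[OF \<beta> D]]
            bilin_scale[OF \<beta>]])
    moreover have "(\<beta> (D x) y + \<beta> x (D y)) - h c * \<beta> x y = 0" if "x \<in> ?E" "y \<in> ?E" for x y
    proof -
      from that obtain \<mu> \<nu> where x: "x \<in> gen_eigen f \<mu>" and y: "y \<in> gen_eigen f \<nu>" by blast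
      \<comment> \<open>Multiplication by \<open>c\<close> plays the role of the map on the target.
        Its shift is multiplication by c - \<mu> \<nu>, so nilpotency at \<open>\<beta> x y\<close>
        forces c = \<mu> \<nu> or \<open>\<beta> x y = 0\<close>.\<close>
      have t: "Vector_Spaces.linear (*) (*) ((*) c)" 
        by (simp add: Vector_Spaces.linear_iff vector_space_mult algebra_simps)
      have "field_space.shift (*) ((*) c) (\<mu> * \<nu>) = (\<lambda>w. (c - \<mu> * \<nu>) * w)"
        by (simp add: field_space.shift_def[OF C] fun_eq_iff algebra_simps)
      moreover obtain k where "(field_space.shift (*) ((*) c) (\<mu> * \<nu>) ^^ k) (\<beta> x y) = 0"
        using gen_eigen_bilin[OF assms(1) \<beta> f t f\<beta>[symmetric]] x y unfolding gen_eigen_def by blast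
      moreover have "((\<lambda>w. d * w) ^^ k) w = d ^ k * w" for d w :: complex and k
        by (induction k) simp_all
      ultimately have "c = \<mu> * \<nu> \<or> \<beta> x y = 0" by auto
      moreover have "(\<beta> (D x) y + \<beta> x (D y)) - h c * \<beta> x y = (h \<mu> + h \<nu> - h c) * \<beta> x y"
        by (simp add: Dh[OF x] Dh[OF y] simps algebra_simps)
      ultimately show ?thesis
        using hmult[OF x y] by (cases "x = 0 \<or> y = 0") (auto simp: simps)
    qed
    ultimately have "(\<beta> (D x) y + \<beta> x (D y)) - h c * \<beta> x y = 0"
      by (rule bilin_zero_on_span[OF assms(1) _ sp])
    then show ?thesis by (simp only: h_def right_minus_eq)
  qed
  show ?thesis unfolding log_derivation_def using D 1 2 by (intro exI[of _ D] conjI allI impI) simp_all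
qed

text \<open>Over the reals, \<open>D\<close> is the real part of the map obtained on the complexification.\<close>

definition complexify_scale :: "(real \<Rightarrow> 'b::ab_group_add \<Rightarrow> 'b) \<Rightarrow> complex \<Rightarrow> 'b \<times> 'b \<Rightarrow> 'b \<times> 'b" where
  "complexify_scale s z v = (s (Re z) (fst v) - s (Im z) (snd v), s (Re z) (snd v) + s (Im z) (fst v))"

definition complexify_bilin :: "('b \<Rightarrow> 'b \<Rightarrow> 'c::ab_group_add) \<Rightarrow> 'b \<times> 'b \<Rightarrow> 'b \<times> 'b \<Rightarrow> 'c \<times> 'c" where
  "complexify_bilin \<beta> v w =
     (\<beta> (fst v) (fst w) - \<beta> (snd v) (snd w), \<beta> (fst v) (snd w) + \<beta> (snd v) (fst w))"

lemma log_modulus_real: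
  fixes scale :: "real \<Rightarrow> 'a::ab_group_add \<Rightarrow> 'a"
  assumes "vector_space scale" and f: "Vector_Spaces.linear scale scale f" and inj: "inj f"
    and "p \<noteq> 0" and p: "\<And>x. field_space.poly_map scale p f x = 0"
  shows "\<exists>D. log_derivation scale f (\<lambda>c. ln \<bar>c\<bar>) D"
proof -
  interpret field_space scale using assms(1) by (rule field_space.intro)
  let ?s = "complexify_scale scale"
  note s_def = complexify_scale_def
  interpret C: field_space ?s
    by unfold_locales
      (simp_all add: s_def prod_eq_iff scale_left_distrib scale_right_distrib
        scale_left_diff_distrib scale_right_diff_distrib algebra_simps)
  let ?f = "map_prod f f" and ?p = "map_poly complex_of_real p"
  have fC: "C.lin ?f" by (rule C.linI) (simp_all add: s_def prod_eq_iff hom_simps[OF f])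
  \<comment> \<open>A polynomial with real coefficients acts on the real and imaginary parts
    separately, so the annihilating polynomial carries over to the complexification.\<close>
  have pmC: "C.poly_map (map_poly complex_of_real q) ?f v = map_prod (poly_map q f) (poly_map q f) v" for q v
  proof (induction q)
    case (pCons c q)
    have "C.poly_map (map_poly complex_of_real (pCons c q)) ?f v =
        ?s (of_real c) v + ?f (C.poly_map (map_poly complex_of_real q) ?f v)"
      by (simp only: map_poly_pCons of_real_0 C.poly_map_pCons[OF fC])
    also have "\<dots> = map_prod (poly_map (pCons c q) f) (poly_map (pCons c q) f) v"
      by (simp only: pCons.IH) (simp add: poly_map_pCons[OF f] s_def prod_eq_iff)
    finally show ?case .
  qed (simp add: prod_eq_iff)
  have pC: "C.poly_map ?p ?f v = 0" for v
    by (simp add: pmC p prod_eq_iff)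
  have "?p \<noteq> 0" using \<open>p \<noteq> 0\<close> by (simp add: map_poly_eq_0_iff)
  obtain D where "log_derivation ?s ?f (\<lambda>c. of_real (ln (cmod c))) D"
    using log_modulus_complex[OF C.vector_space_axioms fC prod.inj_map[OF inj inj] \<open>?p \<noteq> 0\<close> pC] by blast
  note D' = this[unfolded log_derivation_def]
  note D = D'[THEN conjunct1] and D1 = D'[THEN conjunct2, THEN conjunct1, rule_format]
    and D2 = D'[THEN conjunct2, THEN conjunct2, rule_format]
  \<comment> \<open>The identities for \<open>D\<close> are evaluated at real vectors
    \<open>(x, 0)\<close>. Their real parts involve only the real part of \<open>D\<close>, because
    the extended bilinear maps and the factor ln |c| are real.\<close>
  define E where "E x = fst (D (x, 0))" for x
  have E: "lin E"
  proof (rule linI)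
    show "E (x + y) = E x + E y" for x y
      using hom_add[OF D, of "(x, 0)" "(y, 0)"] by (simp add: E_def)
    show "E (scale c x) = scale c (E x)" for c x
      using hom_scale[OF D, of "of_real c" "(x, 0)"] by (simp add: E_def s_def)
  qed
  have 1: "E (\<beta> x y) = \<beta> (E x) y + \<beta> x (E y)"
    if \<beta>: "bilin scale scale \<beta>" and f\<beta>: "\<And>x y. f (\<beta> x y) = \<beta> (f x) (f y)" for \<beta> x y
  proof -
    note simps = bilin_simps[OF \<beta>]
    have "bilin ?s ?s (complexify_bilin \<beta>)"
      unfolding bilin_def
      by (intro conjI allI C.linI)
        (simp_all add: complexify_bilin_def s_def simps prod_eq_iff algebra_simps
          scale_right_distrib scale_right_diff_distrib)
    moreover have "?f (complexify_bilin \<beta> v w) = complexify_bilin \<beta> (?f v) (?f w)" for v w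
      by (simp add: complexify_bilin_def hom_simps[OF f] f\<beta>)
    ultimately have "D (complexify_bilin \<beta> (x, 0) (y, 0)) =
        complexify_bilin \<beta> (D (x, 0)) (y, 0) + complexify_bilin \<beta> (x, 0) (D (y, 0))"
      by (rule D1)
    then show ?thesis by (simp add: complexify_bilin_def E_def simps)
  qed
  have 2: "\<beta> (E x) y + \<beta> x (E y) = ln \<bar>c\<bar> * \<beta> x y"
    if \<beta>: "bilin scale (*) \<beta>" and f\<beta>: "\<And>x y. \<beta> (f x) (f y) = c * \<beta> x y" for \<beta> c x y
  proof -
    note simps = bilin_simps[OF \<beta>]
    \<comment> \<open>Pairs are turned into complex numbers because the clause on scaled forms
      requires values in the scalar field.\<close>
    define \<gamma> where "\<gamma> v w = case_prod Complex (complexify_bilin \<beta> v w)" for v w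
    have \<gamma>: "\<gamma> v w = Complex (\<beta> (fst v) (fst w) - \<beta> (snd v) (snd w)) (\<beta> (fst v) (snd w) + \<beta> (snd v) (fst w))"
      for v w by (simp add: \<gamma>_def complexify_bilin_def)
    have "bilin ?s (*) \<gamma>"
      unfolding bilin_def Vector_Spaces.linear_iff
      by (simp add: C.vector_space_axioms vector_space_mult \<gamma> s_def simps complex_eq_iff algebra_simps)
    moreover have "\<gamma> (?f v) (?f w) = of_real c * \<gamma> v w" for v w
      by (simp add: \<gamma> f\<beta> complex_eq_iff algebra_simps)
    ultimately have "\<gamma> (D (x, 0)) (y, 0) + \<gamma> (x, 0) (D (y, 0)) = of_real (ln (cmod (of_real c))) * \<gamma> (x, 0) (y, 0)"
      by (rule D2)
    then show ?thesis by (simp add: \<gamma> E_def simps complex_eq_iff)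
  qed
  show ?thesis unfolding log_derivation_def using E 1 2 by (intro exI[of _ E] conjI allI impI) simp_all
qed

section \<open>Flows of power series of linear maps\<close>

locale normed_fd_space = finite_dimensional_vector_space scale Basis
  for scale :: "'k::{real_normed_field, banach} \<Rightarrow> 'b::ab_group_add \<Rightarrow> 'b" and Basis :: "'b set"

sublocale normed_fd_space \<subseteq> field_space ..

context normed_fd_space
begin

section \<open>Coordinates, a norm and convergent series of vectors\<close>

definition coord :: "'b \<Rightarrow> 'b \<Rightarrow> 'k" where
  "coord b x = representation Basis x b"

lemma coord_linear: "Vector_Spaces.linear scale (*) (coord b)"
  using vector_space_axioms vector_space_mult independent_Basis span_Basis
  by (simp add: Vector_Spaces.linear_iff coord_def representation_add representation_scale)

lemmas coord_simps = hom_simps[OF coord_linear]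

lemma expand: "(\<Sum>b\<in>Basis. scale (coord b x) b) = x"
  unfolding coord_def
  by (rule sum_representation_eq[OF independent_Basis]) (simp_all add: span_Basis finite_Basis)

lemma coord_combination: "b \<in> Basis \<Longrightarrow> coord b (\<Sum>a\<in>Basis. scale (u a) a) = u b"
  by (simp add: coord_simps)
    (simp add: coord_def representation_basis[OF independent_Basis] finite_Basis if_distrib
      cong: if_cong)

lemma coord_eqI:
  assumes "\<And>b. b \<in> Basis \<Longrightarrow> coord b x = coord b y"
  shows "x = y"
proof -
  have "(\<Sum>b\<in>Basis. scale (coord b x) b) = (\<Sum>b\<in>Basis. scale (coord b y) b)"
    using assms by (intro sum.cong) auto
  then show ?thesis by (simp add: expand)
qed

text \<open>The vectors form only an abelian group with scalars, so all analysis goes through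
  coordinates; this is the l1 norm relative to \<open>Basis\<close>.\<close>

definition vec_norm :: "'b \<Rightarrow> real" where
  "vec_norm x = (\<Sum>b\<in>Basis. norm (coord b x))"

lemma vec_norm_nonneg [simp]: "0 \<le> vec_norm x"
  by (simp add: vec_norm_def sum_nonneg)

lemma vec_norm_eq_0: "vec_norm x = 0 \<Longrightarrow> x = 0"
  by (rule coord_eqI) (simp add: vec_norm_def sum_nonneg_eq_0_iff finite_Basis coord_simps)

lemma vec_norm_0 [simp]: "vec_norm 0 = 0"
  by (simp add: vec_norm_def coord_simps)

lemma vec_norm_add: "vec_norm (x + y) \<le> vec_norm x + vec_norm y"
  by (simp add: vec_norm_def coord_simps sum.distrib[symmetric] sum_mono norm_triangle_ineq)

lemma vec_norm_scale: "vec_norm (scale c x) = norm c * vec_norm x"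
  by (simp add: vec_norm_def coord_simps norm_mult sum_distrib_left)

lemma vec_norm_sum: "vec_norm (sum u A) \<le> (\<Sum>a\<in>A. vec_norm (u a))"
  by (induction A rule: infinite_finite_induct) (auto intro: order_trans[OF vec_norm_add])

lemma norm_coord_le: "b \<in> Basis \<Longrightarrow> norm (coord b x) \<le> vec_norm x"
  unfolding vec_norm_def by (rule member_le_sum) (simp_all add: finite_Basis)

lemma linear_bounded:
  assumes f: "lin f"
  obtains C where "0 \<le> C" and "\<And>x. vec_norm (f x) \<le> C * vec_norm x"
proof
  let ?C = "\<Sum>b\<in>Basis. vec_norm (f b)"
  show "0 \<le> ?C" by (simp add: sum_nonneg)
  fix x
  have "f x = (\<Sum>b\<in>Basis. scale (coord b x) (f b))"
    by (subst expand[of x, symmetric]) (simp add: hom_simps[OF f])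
  then have "vec_norm (f x) \<le> (\<Sum>b\<in>Basis. norm (coord b x) * vec_norm (f b))"
    using vec_norm_sum[of "\<lambda>b. scale (coord b x) (f b)" Basis] by (simp add: vec_norm_scale)
  also have "\<dots> \<le> (\<Sum>b\<in>Basis. vec_norm x * vec_norm (f b))"
    by (intro sum_mono mult_right_mono) (simp_all add: norm_coord_le)
  finally show "vec_norm (f x) \<le> ?C * vec_norm x"
    by (simp add: sum_distrib_left mult.commute)
qed

text \<open>Meaningful when the norms are summable, which makes every coordinate series absolutely
  convergent.\<close>

definition vec_sum :: "(nat \<Rightarrow> 'b) \<Rightarrow> 'b" where
  "vec_sum u = (\<Sum>b\<in>Basis. scale (\<Sum>n. coord b (u n)) b)"

lemma coord_summable:
  assumes "summable (\<lambda>n. vec_norm (u n))" and "b \<in> Basis"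
  shows "summable (\<lambda>n. norm (coord b (u n)))"
proof (rule summable_comparison_test[OF _ assms(1)], intro exI allI impI)
  fix n
  show "norm (norm (coord b (u n))) \<le> vec_norm (u n)"
    using norm_coord_le[OF assms(2)] by simp
qed

lemma coord_vec_sum:
  "summable (\<lambda>n. vec_norm (u n)) \<Longrightarrow> b \<in> Basis \<Longrightarrow> (\<lambda>n. coord b (u n)) sums coord b (vec_sum u)"
  by (simp add: vec_sum_def coord_combination summable_norm_cancel[OF coord_summable] summable_sums)

text \<open>In coordinates \<beta> is a finite combination of products of two scalar series, and
  each product is a Cauchy product of absolutely convergent series.\<close>

lemma bilin_vec_sum:
  assumes \<beta>: "bilin scale (*) \<beta>"
    and u: "summable (\<lambda>n. vec_norm (u n))" and v: "summable (\<lambda>n. vec_norm (v n))"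
  shows "(\<lambda>n. \<Sum>i\<le>n. \<beta> (u i) (v (n - i))) sums \<beta> (vec_sum u) (vec_sum v)"
proof -
  have ex: "\<beta> x y = (\<Sum>a\<in>Basis. \<Sum>b\<in>Basis. coord a x * coord b y * \<beta> a b)" for x y
  proof -
    have "\<beta> x y = \<beta> (\<Sum>a\<in>Basis. scale (coord a x) a) (\<Sum>b\<in>Basis. scale (coord b y) b)"
      by (simp add: expand)
    also have "\<dots> = (\<Sum>a\<in>Basis. coord a x * (\<Sum>b\<in>Basis. coord b y * \<beta> a b))"
      by (simp only: hom_sum[OF bilin_left[OF \<beta>], of _ Basis] hom_scale[OF bilin_left[OF \<beta>]])
        (simp only: hom_sum[OF bilin_right[OF \<beta>]] hom_scale[OF bilin_right[OF \<beta>]])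
    also have "\<dots> = (\<Sum>a\<in>Basis. \<Sum>b\<in>Basis. coord a x * (coord b y * \<beta> a b))"
      by (simp only: sum_distrib_left)
    finally show ?thesis by (simp only: mult.assoc)
  qed
  have "(\<lambda>n. \<Sum>i\<le>n. coord a (u i) * coord b (v (n - i))) sums
      (coord a (vec_sum u) * coord b (vec_sum v))" if "a \<in> Basis" "b \<in> Basis" for a b
    using Cauchy_product_sums[OF coord_summable[OF u that(1)] coord_summable[OF v that(2)]]
      coord_vec_sum[OF u that(1)] coord_vec_sum[OF v that(2)] by (simp add: sums_iff)
  then have "(\<lambda>n. \<Sum>a\<in>Basis. \<Sum>b\<in>Basis. (\<Sum>i\<le>n. coord a (u i) * coord b (v (n - i))) * \<beta> a b) sums
      (\<Sum>a\<in>Basis. \<Sum>b\<in>Basis. coord a (vec_sum u) * coord b (vec_sum v) * \<beta> a b)"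
    by (intro sums_sum sums_mult2)
  moreover have "(\<Sum>a\<in>Basis. \<Sum>b\<in>Basis. (\<Sum>i\<le>n. coord a (u i) * coord b (v (n - i))) * \<beta> a b)
      = (\<Sum>i\<le>n. \<beta> (u i) (v (n - i)))" for n
  proof -
    have "(\<Sum>i\<le>n. \<beta> (u i) (v (n - i))) =
        (\<Sum>i\<le>n. \<Sum>a\<in>Basis. \<Sum>b\<in>Basis. coord a (u i) * coord b (v (n - i)) * \<beta> a b)"
      by (subst ex) (rule refl)
    also have "\<dots> = (\<Sum>a\<in>Basis. \<Sum>i\<le>n. \<Sum>b\<in>Basis. coord a (u i) * coord b (v (n - i)) * \<beta> a b)"
      by (rule sum.swap)
    also have "\<dots> = (\<Sum>a\<in>Basis. \<Sum>b\<in>Basis. \<Sum>i\<le>n. coord a (u i) * coord b (v (n - i)) * \<beta> a b)"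
      by (intro sum.cong refl sum.swap)
    finally show ?thesis by (simp add: sum_distrib_right)
  qed
  ultimately show ?thesis by (simp flip: ex)
qed

text \<open>The coefficients of the solution of \<open>\<psi>' = \<psi> B\<close>, \<open>\<psi>(0) = id\<close>, where \<open>B(t) = (\<Sum>k. t\<^sup>k B k)\<close>.\<close>

function flow :: "(nat \<Rightarrow> 'b \<Rightarrow> 'b) \<Rightarrow> nat \<Rightarrow> 'b \<Rightarrow> 'b" where
  "flow B 0 x = x"
| "flow B (Suc n) x = scale (1 / of_nat (Suc n)) (\<Sum>k\<le>n. flow B (n - k) (B k x))"
  by pat_completeness auto
termination
  by (relation "measure (\<lambda>(B, n, x). n)") auto

lemma flow_Suc: "scale (of_nat (Suc n)) (flow B (Suc n) x) = (\<Sum>k\<le>n. flow B (n - k) (B k x))"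
  by (simp del: of_nat_Suc)

declare flow.simps(2) [simp del]

lemma flow_linear:
  assumes "\<And>k. lin (B k)"
  shows "lin (flow B n)"
proof (induction n rule: less_induct)
  case (less n)
  show ?case
  proof (cases n)
    case 0
    then have "flow B n = (\<lambda>x. x)" by (simp add: fun_eq_iff)
    then show ?thesis using lin_id by simp
  next
    case (Suc m)
    then have "flow B n = (\<lambda>x. scale (1 / of_nat (Suc m)) (\<Sum>k\<le>m. flow B (m - k) (B k x)))"
      by (simp add: fun_eq_iff flow.simps(2))
    moreover have "lin \<dots>"
      using Suc by (intro lin_scale lin_sum) (rule lin_comp[OF less assms], simp)
    ultimately show ?thesis by simp
  qed
qed

end

lemma sum_triangle_swap:
  "(\<Sum>k\<le>m. \<Sum>i\<le>m - k. F k i) = (\<Sum>i\<le>m. \<Sum>k\<le>m - i. F k i)" for m :: nat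
proof -
  have "(\<Sum>k\<le>m. \<Sum>i\<le>m - k. F k i) = (\<Sum>k\<le>m. \<Sum>i | i \<in> {..m} \<and> k + i \<le> m. F k i)"
    by (intro sum.cong refl) auto
  also have "\<dots> = (\<Sum>i\<le>m. \<Sum>k | k \<in> {..m} \<and> k + i \<le> m. F k i)"
    by (rule sum.swap_restrict) auto
  also have "\<dots> = (\<Sum>i\<le>m. \<Sum>k\<le>m - i. F k i)"
    by (intro sum.cong refl) auto
  finally show ?thesis .
qed

lemma sum_atMost_rev: "(\<Sum>i\<le>m. F i) = (\<Sum>i\<le>m. F (m - i))" for m :: nat
  by (rule sum.reindex_bij_witness[of _ "\<lambda>i. m - i" "\<lambda>i. m - i"]) auto

text \<open>The product rule for coefficients. A term T i j with i + j = m + 1 has weight i in the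
  first sum and weight j in the second, hence m + 1 in total. The term absent from each sum is the
  one whose weight there is 0.\<close>

lemma sum_leibniz_weights:
  fixes T :: "nat \<Rightarrow> nat \<Rightarrow> 'c::ab_group_add"
  assumes "vector_space s"
  shows "(\<Sum>j\<le>m. s (of_nat (Suc (m - j))) (T (Suc (m - j)) j)) +
         (\<Sum>i\<le>m. s (of_nat (Suc (m - i))) (T i (Suc (m - i)))) =
         s (of_nat (Suc m)) (\<Sum>i\<le>Suc m. T i (Suc m - i))"
proof -
  interpret vector_space s by fact
  have "(\<Sum>j\<le>m. s (of_nat (Suc (m - j))) (T (Suc (m - j)) j)) =
      (\<Sum>i\<le>m. s (of_nat (Suc i)) (T (Suc i) (Suc m - Suc i)))"
    by (subst sum_atMost_rev) (intro sum.cong refl, simp)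
  also have "\<dots> = (\<Sum>i\<le>Suc m. s (of_nat i) (T i (Suc m - i)))"
    by (subst sum.atMost_Suc_shift) simp
  moreover have "(\<Sum>i\<le>m. s (of_nat (Suc (m - i))) (T i (Suc (m - i)))) =
      (\<Sum>i\<le>Suc m. s (of_nat (Suc m - i)) (T i (Suc m - i)))"
    by (simp add: Suc_diff_le del: of_nat_Suc of_nat_diff)
  moreover have "(\<Sum>i\<le>Suc m. s (of_nat i) (T i (Suc m - i))) +
      (\<Sum>i\<le>Suc m. s (of_nat (Suc m - i)) (T i (Suc m - i))) =
      (\<Sum>i\<le>Suc m. s (of_nat (Suc m)) (T i (Suc m - i)))"
    unfolding sum.distrib[symmetric] scale_left_distrib[symmetric] of_nat_add[symmetric]
    by (intro sum.cong refl) simp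
  ultimately show ?thesis by (simp only: scale_sum_right)
qed

context normed_fd_space
begin

text \<open>Read c n as the coefficient of t^n in a path of bilinear maps with c' = c(B ., .) + c(.,
  B .). The pullback of \<beta> under the flow of B satisfies the same equation with the same
  initial value, and in characteristic zero the recursion determines all coefficients.\<close>

lemma flow_bilin:
  assumes B: "\<And>k. lin (B k)" and \<beta>: "bilin scale s2 \<beta>"
    and c0: "\<And>x y. c 0 x y = \<beta> x y"
    and cS: "\<And>n x y. s2 (of_nat (Suc n)) (c (Suc n) x y) =
               (\<Sum>k\<le>n. c (n - k) (B k x) y + c (n - k) x (B k y))"
  shows "c n x y = (\<Sum>i\<le>n. \<beta> (flow B i x) (flow B (n - i) y))"
proof (induction n arbitrary: x y rule: less_induct)
  case (less n)
  have W: "vector_space s2" using bilin_target[OF \<beta>] .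
  show ?case
  proof (cases n)
    case 0
    then show ?thesis by (simp add: c0)
  next
    case (Suc m)
    have IH: "c (m - k) x y = (\<Sum>i\<le>m - k. \<beta> (flow B i x) (flow B (m - k - i) y))" for k x y
      using less[of "m - k" x y] Suc by simp
    have 1: "(\<Sum>k\<le>m. c (m - k) (B k x) y) =
        (\<Sum>j\<le>m. s2 (of_nat (Suc (m - j))) (\<beta> (flow B (Suc (m - j)) x) (flow B j y)))"
    proof -
      have "(\<Sum>k\<le>m. c (m - k) (B k x) y) =
          (\<Sum>k\<le>m. \<Sum>j\<le>m - k. \<beta> (flow B (m - k - j) (B k x)) (flow B j y))"
        unfolding IH
        by (rule sum.cong[OF refl], subst sum_atMost_rev, rule sum.cong[OF refl]) simp
      also have "\<dots> = (\<Sum>j\<le>m. \<Sum>k\<le>m - j. \<beta> (flow B (m - j - k) (B k x)) (flow B j y))"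
        by (subst sum_triangle_swap) (intro sum.cong refl, simp add: add.commute)
      \<comment> \<open>After the exchange of summation the inner sum over k is the right-hand side
        of \<open>flow_Suc\<close>.\<close>
      also have "\<dots> = (\<Sum>j\<le>m. \<beta> (scale (of_nat (Suc (m - j))) (flow B (Suc (m - j)) x)) (flow B j y))"
        by (simp only: flow_Suc hom_sum[OF bilin_left[OF \<beta>]])
      finally show ?thesis by (simp only: hom_scale[OF bilin_left[OF \<beta>]])
    qed
    have 2: "(\<Sum>k\<le>m. c (m - k) x (B k y)) =
        (\<Sum>i\<le>m. s2 (of_nat (Suc (m - i))) (\<beta> (flow B i x) (flow B (Suc (m - i)) y)))"
    proof -
      have "(\<Sum>k\<le>m. c (m - k) x (B k y)) =
          (\<Sum>i\<le>m. \<Sum>k\<le>m - i. \<beta> (flow B i x) (flow B (m - i - k) (B k y)))"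
        unfolding IH by (subst sum_triangle_swap) (intro sum.cong refl, simp add: add.commute)
      also have "\<dots> = (\<Sum>i\<le>m. \<beta> (flow B i x) (scale (of_nat (Suc (m - i))) (flow B (Suc (m - i)) y)))"
        by (simp only: flow_Suc hom_sum[OF bilin_right[OF \<beta>]])
      finally show ?thesis by (simp only: hom_scale[OF bilin_right[OF \<beta>]])
    qed
    have "s2 (of_nat (Suc m)) (c (Suc m) x y) =
        s2 (of_nat (Suc m)) (\<Sum>i\<le>Suc m. \<beta> (flow B i x) (flow B (Suc m - i) y))"
      unfolding cS sum.distrib 1 2 by (rule sum_leibniz_weights[OF W])
    then show ?thesis
      using vector_space.scale_cancel_left[OF W, of "of_nat (Suc m)"] of_nat_neq_0[of m, where 'a='k] Suc by blast
  qed
qed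

text \<open>The coefficients decay like \<sigma>^n for a \<sigma> strictly between \<rho> and 1. The
  recursion reproduces this bound up to the factor C / (\<sigma> - \<rho>), which the division by n
  absorbs once n > N. The finitely many earlier coefficients only determine
  \<open>M\<close>.\<close>

lemma flow_bound:
  assumes B: "\<And>k. lin (B k)" and \<rho>: "0 \<le> \<rho>" "\<rho> < 1" and C: "0 \<le> C"
    and bound: "\<And>k x. vec_norm (B k x) \<le> C * \<rho> ^ k * vec_norm x"
  shows "summable (\<lambda>n. vec_norm (flow B n x))"
proof -
  define \<sigma> where "\<sigma> = (1 + \<rho>) / 2"
  have \<sigma>: "0 < \<sigma>" "\<sigma> < 1" "\<rho> < \<sigma>" using \<rho> by (simp_all add: \<sigma>_def)
  obtain N where N: "C / (\<sigma> - \<rho>) \<le> real N" using real_arch_simple by blast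
  have "\<forall>n. \<exists>c\<ge>0. \<forall>x. vec_norm (flow B n x) \<le> c * vec_norm x"
    by (intro allI, rule linear_bounded[OF flow_linear[of B, OF B]]) blast
  then obtain c where "\<forall>n. 0 \<le> c n \<and> (\<forall>x. vec_norm (flow B n x) \<le> c n * vec_norm x)"
    by (rule choice[THEN exE])
  then have c: "\<And>n. 0 \<le> c n" "\<And>n x. vec_norm (flow B n x) \<le> c n * vec_norm x" by blast+
  define M where "M = (\<Sum>n\<le>N. c n / \<sigma> ^ n)"
  have M: "0 \<le> M" unfolding M_def using c \<sigma> by (intro sum_nonneg) simp
  have "vec_norm (flow B n x) \<le> M * \<sigma> ^ n * vec_norm x" for n x
  proof (induction n arbitrary: x rule: less_induct)
    case (less n)
    show ?case
    proof (cases "n \<le> N")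
      case True
      have "c n / \<sigma> ^ n \<le> M"
        unfolding M_def using True c \<sigma> by (intro member_le_sum[of n _ "\<lambda>n. c n / \<sigma> ^ n"]) auto
      then have "c n \<le> M * \<sigma> ^ n" using \<sigma> by (simp add: field_simps)
      then show ?thesis using c(2)[of n x] by (meson mult_right_mono order_trans vec_norm_nonneg)
    next
      case False
      then obtain m where n: "n = Suc m" and "N \<le> m" by (cases n) auto
      \<comment> \<open>Multiplied by \<sigma> - \<rho>, the sum telescopes to \<sigma>^n -
        \<rho>^n; the exponents match because n = m + 1.\<close>
      have geo: "(\<Sum>k\<le>m. \<sigma> ^ (m - k) * \<rho> ^ k) \<le> \<sigma> ^ n / (\<sigma> - \<rho>)"
      proof -
        have "(\<sigma> - \<rho>) * (\<Sum>k\<le>m. \<sigma> ^ (m - k) * \<rho> ^ k) = \<sigma> ^ n - \<rho> ^ n"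
          unfolding n diff_power_eq_sum lessThan_Suc_atMost
          by (subst sum_atMost_rev) (simp add: mult.commute)
        also have "\<dots> \<le> \<sigma> ^ n" using \<rho> by simp
        finally show ?thesis using \<sigma> by (simp add: field_simps)
      qed
      have "norm (of_nat n :: 'k) * vec_norm (flow B n x) = vec_norm (\<Sum>k\<le>m. flow B (m - k) (B k x))"
        unfolding n flow_Suc[symmetric] vec_norm_scale ..
      also have "\<dots> \<le> (\<Sum>k\<le>m. vec_norm (flow B (m - k) (B k x)))" by (rule vec_norm_sum)
      also have "\<dots> \<le> (\<Sum>k\<le>m. M * \<sigma> ^ (m - k) * (C * \<rho> ^ k * vec_norm x))"
      proof (rule sum_mono)
        fix k
        have "vec_norm (flow B (m - k) (B k x)) \<le> M * \<sigma> ^ (m - k) * vec_norm (B k x)"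
          using n by (intro less) simp
        also have "\<dots> \<le> M * \<sigma> ^ (m - k) * (C * \<rho> ^ k * vec_norm x)"
          using M \<sigma> by (intro mult_left_mono bound) simp
        finally show "vec_norm (flow B (m - k) (B k x)) \<le> M * \<sigma> ^ (m - k) * (C * \<rho> ^ k * vec_norm x)" .
      qed
      also have "\<dots> = M * C * vec_norm x * (\<Sum>k\<le>m. \<sigma> ^ (m - k) * \<rho> ^ k)"
        by (simp add: sum_distrib_left algebra_simps)
      also have "\<dots> \<le> M * C * vec_norm x * (\<sigma> ^ n / (\<sigma> - \<rho>))"
        using M C by (intro mult_left_mono geo) simp
      also have "\<dots> = C / (\<sigma> - \<rho>) * (M * \<sigma> ^ n * vec_norm x)" by simp
      also have "\<dots> \<le> real n * (M * \<sigma> ^ n * vec_norm x)"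
        using N \<open>N \<le> m\<close> n M \<sigma> by (intro mult_right_mono) auto
      finally show ?thesis using n by (simp add: norm_of_nat del: of_nat_Suc)
    qed
  qed
  then have bd: "norm (vec_norm (flow B n x)) \<le> M * \<sigma> ^ n * vec_norm x" for n by simp
  have "summable (\<lambda>n. \<sigma> ^ n)" by (rule summable_geometric) (use \<sigma> in simp)
  then have "summable (\<lambda>n. M * \<sigma> ^ n * vec_norm x)" by (rule summable_mult2[OF summable_mult])
  then show ?thesis by (rule summable_comparison_test'[where N = 0]) (rule bd)
qed

text \<open>The flow at time t = 1, hence the plain sum of the coefficients.\<close>

definition flow_map :: "(nat \<Rightarrow> 'b \<Rightarrow> 'b) \<Rightarrow> 'b \<Rightarrow> 'b" where
  "flow_map B x = vec_sum (\<lambda>n. flow B n x)"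

lemma flow_map_linear:
  assumes B: "\<And>k. lin (B k)" and sm: "\<And>x. summable (\<lambda>n. vec_norm (flow B n x))"
  shows "lin (flow_map B)"
proof (rule linI)
  have s: "(\<lambda>n. coord b (flow B n x)) sums coord b (flow_map B x)" if "b \<in> Basis" for b x
    unfolding flow_map_def using coord_vec_sum[OF sm that] .
  note simps = hom_simps[OF flow_linear[of B, OF B]] coord_simps
  show "flow_map B (x + y) = flow_map B x + flow_map B y" for x y
  proof (rule coord_eqI)
    fix b assume b: "b \<in> Basis"
    show "coord b (flow_map B (x + y)) = coord b (flow_map B x + flow_map B y)"
      using sums_unique2[OF s[OF b, of "x + y"]] sums_add[OF s[OF b, of x] s[OF b, of y]]
      by (simp add: simps)
  qed
  show "flow_map B (scale c x) = scale c (flow_map B x)" for c x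
  proof (rule coord_eqI)
    fix b assume b: "b \<in> Basis"
    show "coord b (flow_map B (scale c x)) = coord b (scale c (flow_map B x))"
      using sums_unique2[OF s[OF b, of "scale c x"]] sums_mult[OF s[OF b, of x], of c]
      by (simp add: simps)
  qed
qed

text \<open>The series on the left is the path of forms evaluated at t = 1; it equals the initial
  form pulled back by the time-one map.\<close>

lemma flow_map_bilin_sums:
  assumes B: "\<And>k. lin (B k)" and sm: "\<And>x. summable (\<lambda>n. vec_norm (flow B n x))"
    and c: "bilin scale (*) (c 0)"
    and cS: "\<And>n x y. of_nat (Suc n) * c (Suc n) x y =
               (\<Sum>k\<le>n. c (n - k) (B k x) y + c (n - k) x (B k y))"
  shows "(\<lambda>n. c n x y) sums c 0 (flow_map B x) (flow_map B y)"
proof -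
  have "(\<lambda>n. c n x y) = (\<lambda>n. \<Sum>i\<le>n. c 0 (flow B i x) (flow B (n - i) y))"
    by (rule ext, rule flow_bilin[of B "(*)" "c 0" c, OF B c refl cS])
  then show ?thesis
    using bilin_vec_sum[OF c sm sm, of x y] by (simp only: flow_map_def)
qed

text \<open>Since every B k is a derivation of \<beta>, the coefficients of the flow at \<beta>(x,
  y) satisfy the recursion in \<open>flow_bilin\<close>, now with values in the space itself. The
  Cauchy product then sums them in each coordinate.\<close>

lemma flow_map_hom:
  assumes B: "\<And>k. lin (B k)" and sm: "\<And>x. summable (\<lambda>n. vec_norm (flow B n x))"
    and \<beta>: "bilin scale scale \<beta>" and der: "\<And>k x y. B k (\<beta> x y) = \<beta> (B k x) y + \<beta> x (B k y)"
  shows "flow_map B (\<beta> x y) = \<beta> (flow_map B x) (flow_map B y)"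
proof (rule coord_eqI)
  fix b assume b: "b \<in> Basis"
  let ?c = "\<lambda>n x y. flow B n (\<beta> x y)"
  have fl: "flow B n (\<beta> x y) = (\<Sum>i\<le>n. \<beta> (flow B i x) (flow B (n - i) y))" for n
    by (rule flow_bilin[of B scale \<beta> ?c, OF B \<beta>])
      (simp_all add: flow_Suc der hom_simps[OF flow_linear[of B, OF B]] del: of_nat_Suc)
  have "bilin scale (*) (\<lambda>x y. coord b (\<beta> x y))"
    using \<beta> coord_linear[of b] by (simp add: bilin_def Vector_Spaces.linear_iff)
  from bilin_vec_sum[OF this sm sm, of x y]
  have "(\<lambda>n. coord b (flow B n (\<beta> x y))) sums coord b (\<beta> (flow_map B x) (flow_map B y))"
    by (simp add: fl coord_simps flow_map_def)
  moreover have "(\<lambda>n. coord b (flow B n (\<beta> x y))) sums coord b (flow_map B (\<beta> x y))"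
    unfolding flow_map_def by (rule coord_vec_sum[OF sm b])
  ultimately show "coord b (flow_map B (\<beta> x y)) = coord b (\<beta> (flow_map B x) (flow_map B y))"
    by (rule sums_unique2[symmetric])
qed

end

section \<open>Annihilating polynomials\<close>

context finite_dimensional_vector_space
begin

interpretation field_space scale ..

text \<open>A space of dimension d cannot contain d + 1 independent iterates of x. Dependence is a
  property of a set, so a repetition among the iterates is a separate case, with the difference of
  the two equal ones as the relation.\<close>

lemma annihilating_poly_vector:
  assumes f: "lin f"
  shows "\<exists>p. p \<noteq> 0 \<and> poly_map p f x = 0"
proof -
  let ?v = "\<lambda>i. (f ^^ i) x" and ?d = "dimension"
  have coeffs: "\<exists>p. p \<noteq> 0 \<and> poly_map p f x = 0"
    if u: "(\<Sum>i\<le>?d. scale (u i) (?v i)) = 0" "i \<le> ?d" "u i \<noteq> 0" for u i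
  proof -
    define p where "p = (\<Sum>i\<le>?d. monom (u i) i)"
    have monom: "poly_map (monom a n) f y = scale a ((f ^^ n) y)" for a n y
      by (induction n)
        (simp_all add: monom_0 monom_Suc poly_map_pCons[OF f] hom_simps[OF f])
    have "poly_map (\<Sum>i\<in>A. monom (u i) i) f x = (\<Sum>i\<in>A. scale (u i) (?v i))" for A
      by (induction A rule: infinite_finite_induct) (simp_all add: poly_map_add[OF f] monom)
    then have "poly_map p f x = 0" using u(1) by (simp add: p_def)
    moreover have "coeff p i = u i"
      using u(2) by (simp add: p_def coeff_sum)
    then have "p \<noteq> 0" using u(3) by auto
    ultimately show ?thesis by blast
  qed
  show ?thesis
  proof (cases "inj_on ?v {..?d}")
    case True
    then have "card (?v ` {..?d}) = Suc ?d" by (simp add: card_image)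
    then have "dependent (?v ` {..?d})"
      using independent_card_le_dim[of "?v ` {..?d}" UNIV] by (auto simp: dimension_def)
    then obtain w where w: "(\<Sum>v\<in>?v ` {..?d}. scale (w v) v) = 0" "\<exists>v\<in>?v ` {..?d}. w v \<noteq> 0"
      unfolding dependent_finite[OF finite_imageI[OF finite_atMost]] by blast
    then show ?thesis
      using coeffs[of "\<lambda>i. w (?v i)"] by (auto simp: sum.reindex[OF True])
  next
    case False
    then obtain i j where ij: "i \<le> ?d" "j \<le> ?d" "i \<noteq> j" "?v i = ?v j"
      by (auto simp: inj_on_def)
    let ?u = "\<lambda>l. if l = i then 1 else if l = j then - 1 else 0"
    have "(\<Sum>l\<le>?d. scale (?u l) (?v l)) = (\<Sum>l\<in>{i, j}. scale (?u l) (?v l))"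
      using ij by (intro sum.mono_neutral_right) auto
    also have "\<dots> = 0" using ij by simp
    finally show ?thesis using coeffs[of ?u i] ij by simp
  qed
qed

lemma annihilating_poly:
  assumes f: "lin f"
  obtains p where "p \<noteq> 0" and "\<And>x. poly_map p f x = 0"
proof -
  have "\<forall>b. \<exists>p. p \<noteq> 0 \<and> poly_map p f b = 0" using annihilating_poly_vector[OF f] by blast
  then obtain q where q: "\<And>b. q b \<noteq> 0" "\<And>b. poly_map (q b) f b = 0" by metis
  define p where "p = prod q Basis"
  have "p \<noteq> 0" using q(1) finite_Basis by (simp add: p_def)
  moreover have "poly_map p f x = 0" for x
  proof -
    have "poly_map p f b = 0" if "b \<in> Basis" for b
    proof -
      have "p = prod q (Basis - {b}) * q b"
        using that finite_Basis by (simp add: p_def prod.remove mult.commute)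
      then show ?thesis
        by (simp only: poly_map_mult[OF f] q(2) hom_zero[OF lin_poly_map[OF f]])
    qed
    moreover have "subspace {x. poly_map p f x = 0}"
      by (simp add: subspace_def hom_simps[OF lin_poly_map[OF f]])
    ultimately have "span Basis \<subseteq> {x. poly_map p f x = 0}"
      by (intro span_minimal) auto
    then show ?thesis using span_Basis by auto
  qed
  ultimately show ?thesis using that by blast
qed

end

context field_space
begin

lemma poly_map_eigenvector:
  assumes f: "lin f" and x: "f x = scale c x"
  shows "poly_map p f x = scale (poly p c) x"
  by (induction p)
    (simp_all add: poly_map_pCons[OF f] hom_simps[OF f] x scale_left_distrib mult.commute)

lemma lin_inv:
  assumes f: "lin f" and "bij f"
  shows "lin (inv f)"
proof (rule linI)
  have *: "f (inv f x) = x" "inv f (f x) = x" for x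
    using \<open>bij f\<close> by (simp_all add: bij_is_surj surj_f_inv_f bij_is_inj)
  have "inv f (x + y) = inv f (f (inv f x + inv f y))" for x y
    by (simp only: hom_add[OF f] *(1))
  then show "inv f (x + y) = inv f x + inv f y" for x y by (simp only: *(2))
  have "inv f (scale c x) = inv f (f (scale c (inv f x)))" for c x
    by (simp only: hom_scale[OF f] *(1))
  then show "inv f (scale c x) = scale c (inv f x)" for c x by (simp only: *(2))
qed

lemma lin_inj_iff: "lin f \<Longrightarrow> inj f \<longleftrightarrow> (\<forall>x. f x = 0 \<longrightarrow> x = 0)"
  using module_hom.inj_iff_eq_0[of scale scale f] by (simp add: module_hom_iff_linear)

end

section \<open>Ad-invariant metrics as self-adjoint maps\<close>

sublocale lie_algebra \<subseteq> field_space ..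

context lie_algebra
begin

section \<open>Centroid, derivations and automorphisms\<close>

lemma bracket_bilin: "bilin scale scale bracket"
  by (simp add: bilin_def bracket_linear_left bracket_linear_right)

lemmas bracket_simps = bilin_simps[OF bracket_bilin]

lemma bracket_skew: "bracket x y = - bracket y x"
proof -
  have "bracket (x + y) (x + y) = bracket x (x + y) + bracket y (x + y)"
    by (rule hom_add[OF bilin_left[OF bracket_bilin]])
  then have "bracket x y + bracket y x = 0" by (simp add: bracket_simps bracket_self)
  then show ?thesis by (simp add: eq_neg_iff_add_eq_0)
qed

lemma ad_invariant_map_lin: "ad_invariant_map \<phi> \<Longrightarrow> lin \<phi>"
  and ad_invariant_map_right: "ad_invariant_map \<phi> \<Longrightarrow> \<phi> (bracket x y) = bracket x (\<phi> y)"
  by (simp_all add: ad_invariant_map_def)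

lemma ad_invariant_map_left:
  assumes "ad_invariant_map \<phi>"
  shows "\<phi> (bracket x y) = bracket (\<phi> x) y"
proof -
  have "\<phi> (bracket x y) = - \<phi> (bracket y x)"
    by (subst bracket_skew) (rule hom_uminus[OF ad_invariant_map_lin[OF assms]])
  also have "\<dots> = bracket (\<phi> x) y"
    by (simp add: ad_invariant_map_right[OF assms] bracket_skew[of "\<phi> x"])
  finally show ?thesis .
qed

lemma ad_invariant_map_id: "ad_invariant_map (\<lambda>x. x)"
  by (simp add: ad_invariant_map_def lin_id)

lemma ad_invariant_map_comp:
  "ad_invariant_map \<phi> \<Longrightarrow> ad_invariant_map \<chi> \<Longrightarrow> ad_invariant_map (\<lambda>x. \<phi> (\<chi> x))"
  by (simp add: ad_invariant_map_def lin_comp)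

lemma ad_invariant_map_add:
  "ad_invariant_map \<phi> \<Longrightarrow> ad_invariant_map \<chi> \<Longrightarrow> ad_invariant_map (\<lambda>x. \<phi> x + \<chi> x)"
  by (simp add: ad_invariant_map_def lin_add bracket_simps)

lemma ad_invariant_map_scale: "ad_invariant_map \<phi> \<Longrightarrow> ad_invariant_map (\<lambda>x. scale c (\<phi> x))"
  by (simp add: ad_invariant_map_def lin_scale bracket_simps)

lemma ad_invariant_map_inv:
  assumes "ad_invariant_map \<phi>" and "bij \<phi>"
  shows "ad_invariant_map (inv \<phi>)"
  unfolding ad_invariant_map_def
proof (intro conjI allI)
  show "lin (inv \<phi>)" using lin_inv ad_invariant_map_lin assms by blast
  fix x y
  have "\<phi> (bracket x (inv \<phi> y)) = bracket x y"
    using assms by (simp add: ad_invariant_map_right bij_is_surj surj_f_inv_f)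
  then show "inv \<phi> (bracket x y) = bracket x (inv \<phi> y)"
    using \<open>bij \<phi>\<close> by (metis bij_inv_eq_iff)
qed

lemma ad_invariant_map_poly_map:
  assumes "ad_invariant_map \<phi>"
  shows "ad_invariant_map (poly_map p \<phi>)"
proof -
  note f = ad_invariant_map_lin[OF assms]
  have "poly_map p \<phi> (bracket x y) = bracket x (poly_map p \<phi> y)" for x y
    by (induction p)
      (simp_all add: poly_map_pCons[OF f] bracket_simps ad_invariant_map_right[OF assms])
  then show ?thesis by (simp add: ad_invariant_map_def lin_poly_map[OF f])
qed

lemma ad_invariant_map_funpow: "ad_invariant_map \<phi> \<Longrightarrow> ad_invariant_map (\<phi> ^^ n)"
  by (induction n) (simp_all add: ad_invariant_map_id ad_invariant_map_comp id_def comp_def)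

lemma derivation_lin: "derivation D \<Longrightarrow> lin D"
  and derivation_bracket: "derivation D \<Longrightarrow> D (bracket x y) = bracket (D x) y + bracket x (D y)"
  by (simp_all add: derivation_def)

lemma derivation_scale: "derivation D \<Longrightarrow> derivation (\<lambda>x. scale c (D x))"
  by (simp add: derivation_def lin_scale bracket_simps scale_right_distrib)

lemma derivation_diff: "derivation D \<Longrightarrow> derivation E \<Longrightarrow> derivation (\<lambda>x. D x - E x)"
  by (simp add: derivation_def lin_diff bracket_simps)

text \<open>Left multiplication by the centroid preserves derivations; this makes the tangent spaces
  to the orbits of \<open>Aut\<close> at all metrics coincide.\<close>

lemma derivation_centroid:
  assumes "ad_invariant_map \<phi>" "derivation D"
  shows "derivation (\<lambda>x. \<phi> (D x))"
  using assms lin_comp[of \<phi> D]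
  by (simp add: derivation_def ad_invariant_map_lin hom_add[OF ad_invariant_map_lin]
      ad_invariant_map_left[of \<phi> "D _"] ad_invariant_map_right[of \<phi> _ "D _"])

lemma automorphism_comp: "automorphism \<psi> \<Longrightarrow> automorphism \<chi> \<Longrightarrow> automorphism (\<lambda>x. \<psi> (\<chi> x))"
  using bij_comp[of \<chi> \<psi>] by (simp add: automorphism_def lin_comp comp_def)

lemma automorphism_inv:
  assumes "automorphism \<psi>"
  shows "automorphism (inv \<psi>)"
proof -
  have \<psi>: "lin \<psi>" "bij \<psi>" "\<And>x y. \<psi> (bracket x y) = bracket (\<psi> x) (\<psi> y)"
    using assms by (simp_all add: automorphism_def)
  have "\<psi> (bracket (inv \<psi> x) (inv \<psi> y)) = bracket x y" for x y
    using \<psi> by (simp add: bij_is_surj surj_f_inv_f)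
  then have "inv \<psi> (bracket x y) = bracket (inv \<psi> x) (inv \<psi> y)" for x y
    using \<psi>(2) by (metis bij_inv_eq_iff)
  then show ?thesis using \<psi> by (simp add: automorphism_def lin_inv bij_imp_bij_inv)
qed

definition isometric :: "('a \<Rightarrow> 'a \<Rightarrow> 'k) \<Rightarrow> ('a \<Rightarrow> 'a \<Rightarrow> 'k) \<Rightarrow> bool" where
  "isometric h h' \<longleftrightarrow> (\<exists>\<psi>. automorphism \<psi> \<and> (\<forall>x y. h' x y = h (\<psi> x) (\<psi> y)))"

lemma isometric_refl: "isometric h h"
  unfolding isometric_def
  by (rule exI[of _ "\<lambda>x. x"]) (simp add: automorphism_def lin_id bij_id[unfolded id_def])

lemma isometric_sym:
  assumes "isometric h h'"
  shows "isometric h' h"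
proof -
  obtain \<psi> where \<psi>: "automorphism \<psi>" "\<And>x y. h' x y = h (\<psi> x) (\<psi> y)"
    using assms by (auto simp: isometric_def)
  then have "surj \<psi>" by (simp add: automorphism_def bij_is_surj)
  then show ?thesis
    unfolding isometric_def using \<psi> automorphism_inv
    by (intro exI[of _ "inv \<psi>"]) (simp add: surj_f_inv_f)
qed

lemma isometric_trans: "isometric h h' \<Longrightarrow> isometric h' h'' \<Longrightarrow> isometric h h''"
  unfolding isometric_def by (metis automorphism_comp)

end

text \<open>The class of scalars covers the real and the complex case together; real path parameters
  enter through \<open>of_real\<close>.\<close>

locale metric_lie_algebra = finite_dim_lie_algebra scale bracket
  for scale :: "'k::{real_normed_field, banach} \<Rightarrow> 'a::ab_group_add \<Rightarrow> 'a" and bracket +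
  fixes g :: "'a \<Rightarrow> 'a \<Rightarrow> 'k"
  assumes ad_invariant_metric: "ad_invariant_metric g"
begin

lemma metric: "metric g"
  using ad_invariant_metric by (simp add: ad_invariant_metric_def)

lemma g_bilin: "bilin scale (*) g"
  using metric by (simp add: metric_def bilin_def)

lemmas g_simps = bilin_simps[OF g_bilin]

lemma g_sym: "g x y = g y x"
  using metric unfolding metric_def by blast

lemma g_eq_0: "(\<And>y. g x y = 0) \<Longrightarrow> x = 0"
  using metric unfolding metric_def by blast

lemma g_eqI: "(\<And>y. g x y = g x' y) \<Longrightarrow> x = x'"
  using g_eq_0[of "x - x'"] by (simp add: g_simps)

lemma g_bracket: "g (bracket x y) z = - g y (bracket x z)"
  using ad_invariant_metric unfolding ad_invariant_metric_def by blast

lemma inj_imp_bij: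
  assumes "lin f" "inj f"
  shows "bij f"
proof -
  obtain B where "finite_dimensional_vector_space scale B" using finite_dim by blast
  then interpret B: finite_dimensional_vector_space scale B .
  show ?thesis using assms B.linear_inj_imp_surj by (simp add: bij_def)
qed

lemma annihilating_poly_exists:
  assumes "lin f"
  obtains p where "p \<noteq> 0" and "\<And>x. poly_map p f x = 0"
proof -
  obtain B where "finite_dimensional_vector_space scale B" using finite_dim by blast
  then interpret B: finite_dimensional_vector_space scale B .
  show ?thesis using B.annihilating_poly[OF assms] that by blast
qed

lemma finite_eigenvalues:
  assumes f: "lin f"
  shows "finite {c. \<exists>x. x \<noteq> 0 \<and> f x = scale c x}"
proof -
  obtain p where p: "p \<noteq> 0" "\<And>x. poly_map p f x = 0" using annihilating_poly_exists[OF f] by blast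
  have "{c. \<exists>x. x \<noteq> 0 \<and> f x = scale c x} \<subseteq> {c. poly p c = 0}"
    using poly_map_eigenvector[OF f, where p = p] p(2) by auto
  then show ?thesis using poly_roots_finite[OF p(1)] finite_subset by blast
qed

definition sa_map :: "('a \<Rightarrow> 'a) \<Rightarrow> bool" where
  "sa_map \<phi> \<longleftrightarrow> ad_invariant_map \<phi> \<and> (\<forall>x y. g (\<phi> x) y = g x (\<phi> y))"

lemma sa_map_ad: "sa_map \<phi> \<Longrightarrow> ad_invariant_map \<phi>"
  and sa_map_lin: "sa_map \<phi> \<Longrightarrow> lin \<phi>"
  and sa_map_adjoint: "sa_map \<phi> \<Longrightarrow> g (\<phi> x) y = g x (\<phi> y)"
  by (simp_all add: sa_map_def ad_invariant_map_lin)

lemma sa_map_id: "sa_map (\<lambda>x. x)"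
  by (simp add: sa_map_def ad_invariant_map_id)

lemma sa_map_add: "sa_map \<phi> \<Longrightarrow> sa_map \<chi> \<Longrightarrow> sa_map (\<lambda>x. \<phi> x + \<chi> x)"
  by (simp add: sa_map_def ad_invariant_map_add g_simps)

lemma sa_map_scale: "sa_map \<phi> \<Longrightarrow> sa_map (\<lambda>x. scale c (\<phi> x))"
  by (simp add: sa_map_def ad_invariant_map_scale g_simps)

lemma sa_map_sum: "(\<And>i. i \<in> I \<Longrightarrow> sa_map (\<phi> i)) \<Longrightarrow> sa_map (\<lambda>x. \<Sum>i\<in>I. \<phi> i x)"
proof (induction I rule: infinite_finite_induct)
  case (insert i I)
  then show ?case by (simp add: sa_map_add)
qed (use sa_map_scale[OF sa_map_id, of 0] in simp_all)

text \<open>Nondegeneracy turns the equation between maps into one between forms. This removes the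
  definite description in \<open>adjoint_wrt\<close> and matches what flows and logarithms
  deliver.\<close>

lemma solitary_iff:
  "solitary g \<longleftrightarrow>
     (\<forall>\<phi>. sa_map \<phi> \<longrightarrow> (\<exists>D. derivation D \<and> (\<forall>x y. g (D x) y + g x (D y) = g (\<phi> x) y)))"
proof -
  have adj: "adjoint_wrt g \<phi> = \<phi> \<longleftrightarrow> (\<forall>x y. g (\<phi> x) y = g x (\<phi> y))" if "lin \<phi>" for \<phi>
  proof
    show "\<forall>x y. g (\<phi> x) y = g x (\<phi> y)" if "adjoint_wrt g \<phi> = \<phi>"
      using adjoint_wrt_works[OF metric \<open>lin \<phi>\<close>] that by simp
  qed (rule adjoint_wrt_unique[OF metric], blast)
  have sum: "(\<forall>x. \<phi> x = D x + adjoint_wrt g D x) \<longleftrightarrow> (\<forall>x y. g (D x) y + g x (D y) = g (\<phi> x) y)"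
    if "derivation D" for D \<phi>
  proof -
    have "g x (D y) = g (adjoint_wrt g D x) y" for x y
      using adjoint_wrt_works[OF metric derivation_lin[OF that], of y x] g_sym[of x "D y"]
        g_sym[of y "adjoint_wrt g D x"] by simp
    then have *: "g (D x) y + g x (D y) = g (D x + adjoint_wrt g D x) y" for x y
      by (simp add: g_simps)
    show ?thesis unfolding * by (auto intro: g_eqI)
  qed
  have "ad_invariant_map \<phi> \<and> adjoint_wrt g \<phi> = \<phi> \<longleftrightarrow> sa_map \<phi>" for \<phi>
    using adj ad_invariant_map_lin by (auto simp: sa_map_def)
  moreover have "(\<exists>D. derivation D \<and> (\<forall>x. \<phi> x = D x + adjoint_wrt g D x)) \<longleftrightarrow>
      (\<exists>D. derivation D \<and> (\<forall>x y. g (D x) y + g x (D y) = g (\<phi> x) y))" for \<phi>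
    using sum by blast
  ultimately show ?thesis
    unfolding solitary_def using ad_invariant_metric by simp
qed

text \<open>If g w y is nonzero, the functional becomes the map x to l(x) w / g w y of rank at most
  one, and the representing vector is the value of its adjoint at y. If g vanishes identically,
  nondegeneracy leaves only the zero space.\<close>

lemma riesz:
  assumes l: "Vector_Spaces.linear scale (*) l"
  obtains z where "\<And>x. l x = g x z"
proof (cases "\<exists>w y. g w y \<noteq> 0")
  case True
  then obtain w y where wy: "g w y \<noteq> 0" by blast
  let ?f = "\<lambda>x. scale (l x) (scale (1 / g w y) w)"
  have L: "lin ?f" by (rule linI) (simp_all add: hom_simps[OF l] scale_left_distrib add_divide_distrib)
  define z where "z = adjoint_wrt g ?f y"
  have z: "g (?f x) y = g x z" for x unfolding z_def by (rule adjoint_wrt_works[OF metric L])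
  have "l x = g x z" for x using z[of x] wy by (simp add: g_simps)
  then show ?thesis by (rule that)
next
  case False
  have 0: "x = 0" for x :: 'a by (rule g_eq_0) (use False in blast)
  have "l x = g x 0" for x
    by (subst 0[of x]) (simp add: hom_zero[OF l] g_simps)
  then show ?thesis by (rule that)
qed

lemma metric_of_sa_map:
  assumes \<phi>: "sa_map \<phi>" and "inj \<phi>"
  shows "ad_invariant_metric (\<lambda>x y. g (\<phi> x) y)"
proof -
  have nd: "x = 0" if "\<forall>y. g (\<phi> x) y = 0" for x
    using g_eq_0[of "\<phi> x"] that lin_inj_iff[OF sa_map_lin[OF \<phi>]] \<open>inj \<phi>\<close> by blast
  have bl: "bilin scale (*) (\<lambda>x y. g (\<phi> x) y)"
    by (rule bilin_comp_left[OF g_bilin sa_map_lin[OF \<phi>]])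
  have sy: "g (\<phi> x) y = g (\<phi> y) x" for x y
    using sa_map_adjoint[OF \<phi>, of x y] g_sym[of x "\<phi> y"] by simp
  have ai: "g (\<phi> (bracket x y)) z = - g (\<phi> y) (bracket x z)" for x y z
    by (simp only: ad_invariant_map_right[OF sa_map_ad[OF \<phi>]] g_bracket)
  show ?thesis
    unfolding ad_invariant_metric_def metric_def
  proof (intro conjI allI impI)
    show "Vector_Spaces.linear scale (*) (\<lambda>x. g (\<phi> x) y)" for y by (rule bilin_left[OF bl])
    show "Vector_Spaces.linear scale (*) (\<lambda>y. g (\<phi> x) y)" for x by (rule bilin_right[OF bl])
  qed (rule sy nd ai; assumption?)+
qed

lemma sa_map_of_metric:
  assumes "ad_invariant_metric g'"
  obtains \<phi> where "sa_map \<phi>" and "inj \<phi>" and "\<And>x y. g' x y = g (\<phi> x) y"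
proof -
  interpret g': metric_lie_algebra scale bracket g'
    by unfold_locales (fact assms)
  have "\<forall>y. \<exists>z. \<forall>x. g' x y = g x z"
    by (rule allI, rule riesz[OF bilin_left[OF g'.g_bilin]]) blast
  then obtain \<phi> where "\<forall>y x. g' x y = g x (\<phi> y)" by (rule choice[THEN exE])
  then have *: "g' x y = g (\<phi> x) y" for x y
    using g'.g_sym[of x y] g_sym[of y "\<phi> x"] by simp
  have "lin \<phi>"
    by (rule linI; rule g_eqI) (simp_all only: g_simps *[symmetric] g'.g_simps)
  moreover have "\<phi> (bracket x y) = bracket x (\<phi> y)" for x y
  proof (rule g_eqI)
    fix z
    show "g (\<phi> (bracket x y)) z = g (bracket x (\<phi> y)) z"
      by (simp only: *[symmetric] g_bracket g'.g_bracket)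
  qed
  moreover have "g (\<phi> x) y = g x (\<phi> y)" for x y
    using *[of x y] *[of y x] g'.g_sym[of x y] g_sym[of x "\<phi> y"] by simp
  moreover have "x = 0" if "\<phi> x = 0" for x
    using that *[of x] g'.g_eq_0[of x] by (simp add: g_simps)
  ultimately show ?thesis
    using that[of \<phi>] * lin_inj_iff by (simp add: sa_map_def ad_invariant_map_def)
qed

end

section \<open>Paths of metrics\<close>

context metric_lie_algebra
begin

abbreviation form :: "('a \<Rightarrow> 'a) \<Rightarrow> 'a \<Rightarrow> 'a \<Rightarrow> 'k" where
  "form \<phi> \<equiv> \<lambda>x y. g (\<phi> x) y"

text \<open>The derivation \<open>B k\<close> is the coefficient of \<open>t\<^sup>k\<close> in \<open>(\<phi> + t \<beta>)\<^sup>-\<^sup>1 F\<close>. The flow \<open>\<psi>\<close> of this path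
  of derivations carries \<open>form \<phi>\<close> to \<open>form (\<phi> + t \<beta>)\<close>; the bound makes it converge at \<open>t = 1\<close>.\<close>

lemma isometric_perturbation:
  assumes B: "finite_dimensional_vector_space scale Basis"
    and \<phi>: "sa_map \<phi>" "inj \<phi>" and \<beta>: "sa_map \<beta>"
    and F: "derivation F" "\<And>x y. g (F x) y + g x (F y) = g (\<beta> x) y"
    and \<rho>: "0 \<le> \<rho>" "\<rho> < 1"
      "\<And>x. normed_fd_space.vec_norm scale Basis (inv \<phi> (\<beta> x)) \<le> \<rho> * normed_fd_space.vec_norm scale Basis x"
  shows "isometric (form \<phi>) (form (\<lambda>x. \<phi> x + \<beta> x))"
proof -
  interpret N: normed_fd_space scale Basis using B by (rule normed_fd_space.intro)
  have bij: "bij \<phi>" by (rule inj_imp_bij[OF sa_map_lin[OF \<phi>(1)] \<phi>(2)])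
  define \<chi> where "\<chi> = inv \<phi>"
  have \<chi>: "ad_invariant_map \<chi>"
    unfolding \<chi>_def by (rule ad_invariant_map_inv[OF sa_map_ad[OF \<phi>(1)] bij])
  have \<phi>\<chi>: "\<phi> (\<chi> x) = x" "\<chi> (\<phi> x) = x" for x
    unfolding \<chi>_def using bij by (simp_all add: bij_is_surj surj_f_inv_f bij_is_inj)
  \<comment> \<open>The ratio of the geometric series for the inverse of \<phi> + t \<beta>, which
    is the sum of t^k \<mu>^k \<chi>.\<close>
  define \<mu> where "\<mu> x = scale (- 1) (\<chi> (\<beta> x))" for x
  have \<mu>: "ad_invariant_map \<mu>"
    unfolding \<mu>_def by (rule ad_invariant_map_scale[OF ad_invariant_map_comp[OF \<chi> sa_map_ad[OF \<beta>]]])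
  have \<phi>\<mu>: "\<phi> (\<mu> x) = - \<beta> x" for x
    by (simp add: \<mu>_def hom_simps[OF sa_map_lin[OF \<phi>(1)]] \<phi>\<chi>)
  define B where "B k x = (\<mu> ^^ k) (\<chi> (F x))" for k x
  have derB: "derivation (B k)" for k
    unfolding B_def
    by (rule derivation_centroid[OF ad_invariant_map_funpow[OF \<mu>] derivation_centroid[OF \<chi> F(1)]])
  have linB: "lin (B k)" for k using derivation_lin[OF derB] .
  have \<mu>_norm: "N.vec_norm ((\<mu> ^^ k) x) \<le> \<rho> ^ k * N.vec_norm x" for k x
  proof (induction k)
    case (Suc k)
    have "N.vec_norm (\<mu> y) \<le> \<rho> * N.vec_norm y" for y
      using \<rho>(3)[of y] by (simp add: \<mu>_def \<chi>_def N.vec_norm_scale del: scale_minus_left)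
    then have "N.vec_norm ((\<mu> ^^ Suc k) x) \<le> \<rho> * N.vec_norm ((\<mu> ^^ k) x)" by simp
    also have "\<dots> \<le> \<rho> * (\<rho> ^ k * N.vec_norm x)" using Suc \<rho>(1) by (rule mult_left_mono)
    finally show ?case by (simp add: mult.assoc)
  qed simp
  obtain C where C: "0 \<le> C" "\<And>x. N.vec_norm (\<chi> (F x)) \<le> C * N.vec_norm x"
    by (rule N.linear_bounded[OF lin_comp[OF ad_invariant_map_lin[OF \<chi>] derivation_lin[OF F(1)]]]) blast
  have bound: "N.vec_norm (B k x) \<le> C * \<rho> ^ k * N.vec_norm x" for k x
  proof -
    have "N.vec_norm (B k x) \<le> \<rho> ^ k * N.vec_norm (\<chi> (F x))" unfolding B_def by (rule \<mu>_norm)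
    also have "\<dots> \<le> \<rho> ^ k * (C * N.vec_norm x)" using \<rho>(1) by (intro mult_left_mono C) simp
    finally show ?thesis by (simp only: mult.assoc mult.left_commute)
  qed
  have sm: "summable (\<lambda>n. N.vec_norm (N.flow B n x))" for x
    by (rule N.flow_bound[of B, OF linB \<rho>(1,2) C(1) bound])
  \<comment> \<open>The path \<phi> + t \<beta> is affine in t, so only its first two coefficients
    are nonzero.\<close>
  define c where "c n x y = (if n = 0 then g (\<phi> x) y else if n = 1 then g (\<beta> x) y else 0)" for n :: nat and x y
  have cbil: "bilin scale (*) (c 0)"
    unfolding c_def using bilin_comp_left[OF g_bilin sa_map_lin[OF \<phi>(1)]] by simp
  have cS: "of_nat (Suc n) * c (Suc n) x y = (\<Sum>k\<le>n. c (n - k) (B k x) y + c (n - k) x (B k y))" for n x y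
  proof (cases n)
    case 0
    have "g (\<phi> (\<chi> (F x))) y + g (\<phi> x) (\<chi> (F y)) = g (\<beta> x) y"
      by (simp add: \<phi>\<chi> sa_map_adjoint[OF \<phi>(1)] F(2))
    then show ?thesis by (simp add: 0 c_def B_def)
  next
    \<comment> \<open>The path has no coefficient of degree n + 1 here. On the right only k = n,
      paired with \<phi>, and k = m, paired with \<beta>, remain, and they cancel because \<phi>
      \<mu> = - \<beta>.\<close>
    case (Suc m)
    have "\<phi> (B (Suc m) z) = - \<beta> (B m z)" for z by (simp add: B_def \<phi>\<mu>)
    then have "c 0 (B (Suc m) x) y + c 0 x (B (Suc m) y) + (c 1 (B m x) y + c 1 x (B m y)) = 0"
      by (simp add: c_def sa_map_adjoint[OF \<phi>(1), of x] sa_map_adjoint[OF \<beta>, of x] g_simps)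
    moreover have "(\<Sum>k\<le>n. c (n - k) (B k x) y + c (n - k) x (B k y)) =
        (\<Sum>k\<in>{m, Suc m}. c (n - k) (B k x) y + c (n - k) x (B k y))"
      using Suc by (intro sum.mono_neutral_right) (auto simp: c_def)
    ultimately show ?thesis using Suc by (simp add: c_def add.commute)
  qed
  define \<psi> where "\<psi> = N.flow_map B"
  have iso: "g (\<phi> x + \<beta> x) y = g (\<phi> (\<psi> x)) (\<psi> y)" for x y
  proof -
    have "(\<lambda>n. c n x y) sums c 0 (\<psi> x) (\<psi> y)"
      unfolding \<psi>_def by (rule N.flow_map_bilin_sums[of B c, OF linB sm cbil cS])
    moreover have "(\<lambda>n. c n x y) sums (\<Sum>n\<in>{0, 1}. c n x y)"
      by (rule sums_finite) (auto simp: c_def)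
    ultimately have "c 0 (\<psi> x) (\<psi> y) = (\<Sum>n\<in>{0, 1}. c n x y)" by (rule sums_unique2)
    then show ?thesis by (simp add: c_def g_simps)
  qed
  have lin\<psi>: "lin \<psi>" unfolding \<psi>_def by (rule N.flow_map_linear[of B, OF linB sm])
  \<comment> \<open>A kernel vector of \<psi> lies in the kernel of \<phi> + \<beta>, hence is fixed
    by \<mu>, which contracts the norm by \<rho> < 1.\<close>
  have "x = 0" if "\<psi> x = 0" for x
  proof -
    have "g (\<phi> x + \<beta> x) y = 0" for y
      unfolding iso using that by (simp add: hom_zero[OF sa_map_lin[OF \<phi>(1)]] g_simps)
    then have "\<phi> x + \<beta> x = 0" by (rule g_eq_0)
    then have "\<chi> (\<phi> x + \<beta> x) = 0" using hom_zero[OF ad_invariant_map_lin[OF \<chi>]] by simp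
    then have "x = \<mu> x"
      by (simp add: \<mu>_def hom_add[OF ad_invariant_map_lin[OF \<chi>]] \<phi>\<chi> eq_neg_iff_add_eq_0)
    then have "N.vec_norm x \<le> \<rho> * N.vec_norm x" using \<mu>_norm[of 1 x] by simp
    then have "(1 - \<rho>) * N.vec_norm x \<le> 0" by (simp add: algebra_simps)
    then have "N.vec_norm x \<le> 0" using \<rho>(2) by (simp add: mult_le_0_iff)
    then show ?thesis using N.vec_norm_eq_0 N.vec_norm_nonneg[of x] by (meson order_antisym)
  qed
  then have "inj \<psi>" using lin_inj_iff[OF lin\<psi>] by blast
  then have "automorphism \<psi>"
    unfolding automorphism_def using lin\<psi> inj_imp_bij[OF lin\<psi>]
      N.flow_map_hom[of B, OF linB sm bracket_bilin derivation_bracket[OF derB]]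
    by (simp add: \<psi>_def)
  then show ?thesis unfolding isometric_def using iso by blast
qed

text \<open>Being isometric is locally constant along a segment of nondegenerate forms.\<close>

lemma isometric_segment:
  assumes sol: "solitary g" and \<phi>: "sa_map \<phi>" and \<beta>: "sa_map \<beta>"
    and inj: "\<And>t x. 0 \<le> t \<Longrightarrow> t \<le> 1 \<Longrightarrow> \<phi> x + scale (of_real t) (\<beta> x) = 0 \<Longrightarrow> x = 0"
  shows "isometric (form \<phi>) (form (\<lambda>x. \<phi> x + \<beta> x))"
proof -
  obtain Basis where Basis: "finite_dimensional_vector_space scale Basis" using finite_dim by blast
  interpret N: normed_fd_space scale Basis using Basis by (rule normed_fd_space.intro)
  define \<phi>t where "\<phi>t t x = \<phi> x + scale (of_real t) (\<beta> x)" for t :: real and x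
  have sa: "sa_map (\<phi>t t)" for t
    unfolding \<phi>t_def by (rule sa_map_add[OF \<phi> sa_map_scale[OF \<beta>]])
  have local: "\<exists>d>0. \<forall>s. \<bar>s - t\<bar> < d \<longrightarrow> isometric (form (\<phi>t t)) (form (\<phi>t s))"
    if t: "0 \<le> t" "t \<le> 1" for t
  proof -
    have inj_t: "inj (\<phi>t t)"
      unfolding lin_inj_iff[OF sa_map_lin[OF sa]] \<phi>t_def using inj[OF t] by blast
    have bij_t: "bij (\<phi>t t)" by (rule inj_imp_bij[OF sa_map_lin[OF sa] inj_t])
    have lin_inv: "lin (inv (\<phi>t t))" by (rule lin_inv[OF sa_map_lin[OF sa] bij_t])
    obtain C where C: "0 \<le> C" "\<And>x. N.vec_norm (inv (\<phi>t t) (\<beta> x)) \<le> C * N.vec_norm x"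
      by (rule N.linear_bounded[OF lin_comp[OF lin_inv sa_map_lin[OF \<beta>]]]) blast
    \<comment> \<open>The radius 1 / (C + 1) makes the contraction constant |s - t| C less than 1
      and is defined also for C = 0.\<close>
    have "isometric (form (\<phi>t t)) (form (\<phi>t s))" if s: "\<bar>s - t\<bar> < 1 / (C + 1)" for s
    proof -
      let ?\<beta> = "\<lambda>x. scale (of_real (s - t)) (\<beta> x)"
      have sa\<beta>: "sa_map ?\<beta>" by (rule sa_map_scale[OF \<beta>])
      \<comment> \<open>Solitarity is applied to the increment alone, with no reference to the base
        point \<open>\<phi>t t\<close>; hence it can be used all along the segment.\<close>
      obtain F where F: "derivation F" "\<And>x y. g (F x) y + g x (F y) = g (?\<beta> x) y"
        using sol sa\<beta> unfolding solitary_iff by blast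
      have \<rho>: "\<bar>s - t\<bar> * C < 1"
      proof -
        have "\<bar>s - t\<bar> * C \<le> \<bar>s - t\<bar> * (C + 1)" by (simp add: mult_left_mono)
        also have "\<dots> < 1" using s C(1) by (simp add: field_simps)
        finally show ?thesis .
      qed
      have "N.vec_norm (inv (\<phi>t t) (?\<beta> x)) \<le> \<bar>s - t\<bar> * C * N.vec_norm x" for x
      proof -
        have "N.vec_norm (inv (\<phi>t t) (?\<beta> x)) = \<bar>s - t\<bar> * N.vec_norm (inv (\<phi>t t) (\<beta> x))"
          by (simp only: hom_scale[OF lin_inv] N.vec_norm_scale norm_of_real)
        also have "\<dots> \<le> \<bar>s - t\<bar> * (C * N.vec_norm x)" by (intro mult_left_mono C) simp
        finally show ?thesis by (simp only: mult.assoc)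
      qed
      then have "isometric (form (\<phi>t t)) (form (\<lambda>x. \<phi>t t x + ?\<beta> x))"
        using C(1) \<rho> by (intro isometric_perturbation[OF Basis sa inj_t sa\<beta> F]) auto
      moreover have "\<phi>t t x + ?\<beta> x = \<phi>t s x" for x
        by (simp add: \<phi>t_def scale_left_diff_distrib)
      ultimately show ?thesis by (simp only:)
    qed
    then show ?thesis using C(1) by (intro exI[of _ "1 / (C + 1)"]) simp
  qed
  define P where "P a b \<longleftrightarrow> isometric (form (\<phi>t a)) (form (\<phi>t b))" for a b
  have "P 0 1"
  \<comment> \<open>Compactness of the interval: a transitive relation that holds on small intervals
    around each point holds between the end points.\<close>
  proof (rule Bolzano)
    show "P a c" if "P a b" "P b c" for a b c
      using that isometric_trans unfolding P_def by blast
    fix x :: real assume "0 \<le> x" "x \<le> 1"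
    then obtain d where d: "d > 0" "\<And>s. \<bar>s - x\<bar> < d \<Longrightarrow> isometric (form (\<phi>t x)) (form (\<phi>t s))"
      using local by blast
    have "P a b" if "a \<le> x" "x \<le> b" "b - a < d" for a b
      unfolding P_def using isometric_trans[OF isometric_sym[OF d(2)[of a]] d(2)[of b]] that by simp
    then show "\<exists>d>0. \<forall>a b. a \<le> x \<and> x \<le> b \<and> b - a < d \<longrightarrow> P a b" using d(1) by blast
  qed simp
  then show ?thesis by (simp add: P_def \<phi>t_def)
qed

lemma isometric_line:
  assumes sol: "solitary g" and \<phi>: "sa_map \<phi>" and \<chi>: "sa_map \<chi>"
    and inj: "\<And>t x. 0 \<le> t \<Longrightarrow> t \<le> 1 \<Longrightarrow>
      scale (of_real (1 - t)) (\<phi> x) + scale (of_real t) (\<chi> x) = 0 \<Longrightarrow> x = 0"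
  shows "isometric (form \<phi>) (form \<chi>)"
proof -
  let ?\<beta> = "\<lambda>x. \<chi> x + scale (- 1) (\<phi> x)"
  have "isometric (form \<phi>) (form (\<lambda>x. \<phi> x + ?\<beta> x))"
  proof (rule isometric_segment[OF sol \<phi> sa_map_add[OF \<chi> sa_map_scale[OF \<phi>]]])
    fix t :: real and x
    assume t: "0 \<le> t" "t \<le> 1" and "\<phi> x + scale (of_real t) (?\<beta> x) = 0"
    then have "scale (of_real (1 - t)) (\<phi> x) + scale (of_real t) (\<chi> x) = 0"
      by (simp add: scale_right_distrib scale_right_diff_distrib scale_left_diff_distrib algebra_simps)
    then show "x = 0" by (rule inj[OF t])
  qed
  then show ?thesis by simp
qed

end

section \<open>A criterion for solitarity\<close>

context metric_lie_algebra
begin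

text \<open>If D scales the form of an invertible \<chi> infinitesimally by 1, then F = \<chi> D is
  again a derivation and F + F* = \<chi>. A general \<phi> is a difference of two invertible maps,
  and so is handled by the difference of the two derivations.\<close>

lemma solitary_if_homothetic:
  assumes H: "\<And>\<phi>. sa_map \<phi> \<Longrightarrow> inj \<phi> \<Longrightarrow>
    \<exists>D. derivation D \<and> (\<forall>x y. g (\<phi> (D x)) y + g (\<phi> x) (D y) = g (\<phi> x) y)"
  shows "solitary g"
  unfolding solitary_iff
proof (intro allI impI)
  fix \<phi> assume \<phi>: "sa_map \<phi>"
  have ex: "\<exists>F. derivation F \<and> (\<forall>x y. g (F x) y + g x (F y) = g (\<chi> x) y)"
    if \<chi>: "sa_map \<chi>" "inj \<chi>" for \<chi>
  proof -
    obtain D where D: "derivation D" "\<And>x y. g (\<chi> (D x)) y + g (\<chi> x) (D y) = g (\<chi> x) y"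
      using H[OF \<chi>] by blast
    have "derivation (\<lambda>x. \<chi> (D x))" by (rule derivation_centroid[OF sa_map_ad[OF \<chi>(1)] D(1)])
    moreover have "g (\<chi> (D x)) y + g x (\<chi> (D y)) = g (\<chi> x) y" for x y
      using D(2)[of x y] sa_map_adjoint[OF \<chi>(1), of x "D y"] by simp
    ultimately show ?thesis by blast
  qed
  have "finite ({c. \<exists>x. x \<noteq> 0 \<and> \<phi> x = scale c x} \<union> {0})"
    using finite_eigenvalues[OF sa_map_lin[OF \<phi>]] by simp
  \<comment> \<open>Avoiding the eigenvalues makes \<phi> - c injective; avoiding 0 makes the scalar
    map injective.\<close>
  then obtain c where c: "c \<notin> {c. \<exists>x. x \<noteq> 0 \<and> \<phi> x = scale c x} \<union> {0}"
    using ex_new_if_finite[OF infinite_UNIV_char_0] by blast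
  define \<chi> \<kappa> where "\<chi> x = \<phi> x + scale (- c) x" and "\<kappa> x = scale (- c) x" for x
  have \<kappa>: "sa_map \<kappa>" unfolding \<kappa>_def by (rule sa_map_scale[OF sa_map_id])
  have \<chi>: "sa_map \<chi>" unfolding \<chi>_def by (rule sa_map_add[OF \<phi> sa_map_scale[OF sa_map_id]])
  have "inj \<kappa>" using c unfolding lin_inj_iff[OF sa_map_lin[OF \<kappa>]] by (simp add: \<kappa>_def)
  moreover have "inj \<chi>" using c unfolding lin_inj_iff[OF sa_map_lin[OF \<chi>]] by (auto simp: \<chi>_def)
  ultimately obtain E F where E: "derivation E" "\<And>x y. g (E x) y + g x (E y) = g (\<chi> x) y"
    and F: "derivation F" "\<And>x y. g (F x) y + g x (F y) = g (\<kappa> x) y"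
    using ex[OF \<chi>] ex[OF \<kappa>] by blast
  have "g (E x - F x) y + g x (E y - F y) = g (\<phi> x) y" for x y
    using E(2)[of x y] F(2)[of x y] by (simp add: \<chi>_def \<kappa>_def g_simps algebra_simps)
  then show "\<exists>D. derivation D \<and> (\<forall>x y. g (D x) y + g x (D y) = g (\<phi> x) y)"
    using derivation_diff[OF E(1) F(1)] by blast
qed

text \<open>Two of the metrics \<open>2\<^sup>n g(\<phi> \<cdot>, \<cdot>)\<close> are isometric by the pigeonhole principle; this gives an
  automorphism that scales \<open>g(\<phi> \<cdot>, \<cdot>)\<close>, and its logarithm is a homothetic derivation.\<close>

lemma solitary_if_finitely_many_classes:
  assumes log: "\<And>f p. lin f \<Longrightarrow> inj f \<Longrightarrow> p \<noteq> 0 \<Longrightarrow> (\<And>x. poly_map p f x = 0) \<Longrightarrow>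
      \<exists>D. log_derivation scale f l D"
    and l: "\<And>m n :: nat. m < n \<Longrightarrow> l (2 ^ n / 2 ^ m) \<noteq> 0"
    and fin: "finite H" and H: "\<And>g'. ad_invariant_metric g' \<Longrightarrow> \<exists>h\<in>H. isometric h g'"
  shows "solitary g"
proof (rule solitary_if_homothetic)
  fix \<phi> assume \<phi>: "sa_map \<phi>" "inj \<phi>"
  \<comment> \<open>The quotient of two different powers of 2 is a positive real number other than
    1, so its logarithm \<open>l\<close> does not vanish.\<close>
  define \<gamma> where "\<gamma> n = form (\<lambda>x. scale (2 ^ n) (\<phi> x))" for n :: nat
  have "ad_invariant_metric (\<gamma> n)" for n
  proof -
    have "inj (\<lambda>x. scale (2 ^ n) (\<phi> x))"
      using \<phi>(2) by (auto simp: inj_def)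
    then show ?thesis unfolding \<gamma>_def by (rule metric_of_sa_map[OF sa_map_scale[OF \<phi>(1)]])
  qed
  then have "\<forall>n. \<exists>h. h \<in> H \<and> isometric h (\<gamma> n)" using H by blast
  then obtain h where h: "\<And>n. h n \<in> H" "\<And>n. isometric (h n) (\<gamma> n)"
    using choice[of "\<lambda>n h. h \<in> H \<and> isometric h (\<gamma> n)"] by blast
  have "finite (range h)" using h(1) fin by (meson finite_subset image_subsetI)
  then have "\<not> inj h" using finite_imageD infinite_UNIV_nat by blast
  then obtain m n where mn: "m < n" "h m = h n" unfolding inj_def by (metis linorder_neqE_nat)
  have "isometric (\<gamma> m) (\<gamma> n)" using h(2)[of m] h(2)[of n] mn(2) isometric_sym isometric_trans by metis
  then obtain \<psi> where \<psi>: "automorphism \<psi>" and iso: "\<And>x y. \<gamma> n x y = \<gamma> m (\<psi> x) (\<psi> y)"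
    unfolding isometric_def by blast
  define c :: 'k where "c = 2 ^ n / 2 ^ m"
  have c: "g (\<phi> (\<psi> x)) (\<psi> y) = c * g (\<phi> x) y" for x y
    using iso[of x y] by (simp add: \<gamma>_def c_def g_simps field_simps)
  have lin\<psi>: "lin \<psi>" and "inj \<psi>" using \<psi> by (simp_all add: automorphism_def bij_is_inj)
  obtain p where "p \<noteq> 0" "\<And>x. poly_map p \<psi> x = 0" using annihilating_poly_exists[OF lin\<psi>] by blast
  then obtain D where D: "log_derivation scale \<psi> l D" using log[OF lin\<psi> \<open>inj \<psi>\<close>] by blast
  have "D (bracket x y) = bracket (D x) y + bracket x (D y)" for x y
    using D bracket_bilin \<psi> unfolding log_derivation_def automorphism_def by blast
  then have der: "derivation D" using D by (simp add: derivation_def log_derivation_def)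
  have "bilin scale (*) (form \<phi>)" by (rule bilin_comp_left[OF g_bilin sa_map_lin[OF \<phi>(1)]])
  then have hom: "g (\<phi> (D x)) y + g (\<phi> x) (D y) = l c * g (\<phi> x) y" for x y
    using D[unfolded log_derivation_def, THEN conjunct2, THEN conjunct2, THEN spec, of "form \<phi>"] c by simp
  \<comment> \<open>Rescaling the derivation normalizes the infinitesimal factor from
    \<open>l c\<close> to 1.\<close>
  have "g (\<phi> (scale (1 / l c) (D x))) y + g (\<phi> x) (scale (1 / l c) (D y)) = g (\<phi> x) y" for x y
  proof -
    have "g (\<phi> (scale (1 / l c) (D x))) y + g (\<phi> x) (scale (1 / l c) (D y)) =
        (1 / l c) * (g (\<phi> (D x)) y + g (\<phi> x) (D y))"
      by (simp add: hom_simps[OF sa_map_lin[OF \<phi>(1)]] g_simps add_divide_distrib)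
    also have "\<dots> = g (\<phi> x) y" unfolding hom using l[OF mn(1)] by (simp add: c_def)
    finally show ?thesis .
  qed
  then show "\<exists>D. derivation D \<and> (\<forall>x y. g (\<phi> (D x)) y + g (\<phi> x) (D y) = g (\<phi> x) y)"
    using derivation_scale[OF der, of "1 / l c"] by blast
qed

section \<open>Irreducible ideals\<close>

text \<open>A Fitting decomposition: an annihilating polynomial of \<omega> factors as (X - \<nu>)^n
  q with q(\<nu>) nonzero, and G is the direct sum of the kernels of the two factors in G. The
  eigenvectors y and z show that both kernels are nonzero.\<close>

lemma reducible_of_eigenvalues:
  assumes \<omega>: "ad_invariant_map \<omega>" and G: "lie_ideal UNIV G" and inv: "\<And>x. x \<in> G \<Longrightarrow> \<omega> x \<in> G"
    and y: "y \<in> G" "y \<noteq> 0" "\<omega> y = scale \<nu> y" and z: "z \<in> G" "z \<noteq> 0" "\<omega> z = scale \<mu> z"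
    and "\<nu> \<noteq> \<mu>"
  shows "reducible G"
proof -
  note lin = ad_invariant_map_lin[OF \<omega>]
  have Gs: "subspace G" and Gb: "\<And>x y. y \<in> G \<Longrightarrow> bracket x y \<in> G" using G by (auto simp: lie_ideal_def)
  obtain p where "p \<noteq> 0" and p0: "\<And>x. poly_map p \<omega> x = 0" using annihilating_poly_exists[OF lin] by blast
  let ?X = "[:- \<nu>, 1:]"
  obtain q where p: "p = ?X ^ order \<nu> p * q" and "\<not> ?X dvd q"
    using order_decomp[OF \<open>p \<noteq> 0\<close>] by blast
  define n where "n = order \<nu> p"
  have p: "p = ?X ^ n * q" using p by (simp add: n_def)
  have q: "poly q \<nu> \<noteq> 0" using \<open>\<not> ?X dvd q\<close> by (simp add: poly_eq_0_iff_dvd)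
  have root: "poly p c = 0" if "\<omega> v = scale c v" "v \<noteq> 0" for c v
    using poly_map_eigenvector[OF lin that(1), of p] p0 that(2) by simp
  note pm = poly_map_add[OF lin] poly_map_mult[OF lin]
  have Gp: "poly_map r \<omega> x \<in> G" if "x \<in> G" for r x
    using that
  proof (induction r)
    case 0
    then show ?case by (simp add: subspace_0[OF Gs])
  next
    case (pCons a r)
    then show ?case
      by (simp add: poly_map_pCons[OF lin] subspace_add[OF Gs] subspace_scale[OF Gs] inv)
  qed
  define K where "K r = {x \<in> G. poly_map r \<omega> x = 0}" for r
  \<comment> \<open>Polynomials in \<omega> are ad-invariant as well, so their kernels are stable
    under brackets.\<close>
  have ideal: "lie_ideal G (K r)" for r
    unfolding lie_ideal_def K_def subspace_def
    using subspace_0[OF Gs] subspace_add[OF Gs] subspace_scale[OF Gs] Gb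
    by (auto simp: hom_simps[OF lin_poly_map[OF lin]]
        ad_invariant_map_right[OF ad_invariant_map_poly_map[OF \<omega>]] bracket_simps)
  have "y \<in> K (?X ^ n)"
  proof -
    have "n \<noteq> 0" using root[OF y(3,2)] \<open>p \<noteq> 0\<close> by (simp add: n_def order_root)
    then show ?thesis using y(1) by (simp add: K_def poly_map_eigenvector[OF lin y(3)] poly_power)
  qed
  moreover have "z \<in> K q"
  proof -
    have "poly q \<mu> = 0" using root[OF z(3,2)] \<open>\<nu> \<noteq> \<mu>\<close> by (simp add: p poly_power)
    then show ?thesis using z(1) by (simp add: K_def poly_map_eigenvector[OF lin z(3)])
  qed
  moreover have "K (?X ^ n) \<inter> K q = {0}"
  proof -
    have "x = 0" if "x \<in> K (?X ^ n)" "x \<in> K q" for x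
      using gen_eigen_coprime[OF lin q, of x] gen_eigen_iff[OF lin] that by (auto simp: K_def)
    moreover have "0 \<in> K r" for r using subspace_0[OF Gs] by (simp add: K_def hom_simps[OF lin_poly_map[OF lin]])
    ultimately show ?thesis by blast
  qed
  moreover have "G = {u + v | u v. u \<in> K (?X ^ n) \<and> v \<in> K q}"
  proof
    obtain a b where ab: "a * ?X ^ n + b * q = 1" using linear_power_bezout[OF q] .
    show "G \<subseteq> {u + v | u v. u \<in> K (?X ^ n) \<and> v \<in> K q}"
    proof
      fix x assume x: "x \<in> G"
      have "poly_map (?X ^ n) \<omega> (poly_map (b * q) \<omega> x) = poly_map (b * p) \<omega> x"
        unfolding pm(2)[symmetric] p by (simp only: ac_simps)
      moreover have "poly_map q \<omega> (poly_map (a * ?X ^ n) \<omega> x) = poly_map (a * p) \<omega> x"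
        unfolding pm(2)[symmetric] p by (simp only: ac_simps)
      moreover have "poly_map (r * p) \<omega> x = 0" for r
        by (simp only: pm(2) p0 hom_zero[OF lin_poly_map[OF lin]])
      ultimately have "poly_map (b * q) \<omega> x \<in> K (?X ^ n)" "poly_map (a * ?X ^ n) \<omega> x \<in> K q"
        using Gp[OF x] by (simp_all only: K_def mem_Collect_eq)
      moreover have "x = poly_map (b * q) \<omega> x + poly_map (a * ?X ^ n) \<omega> x"
        unfolding pm(1)[symmetric] using ab poly_map_1[OF lin] by (simp only: add.commute)
      ultimately show "x \<in> {u + v | u v. u \<in> K (?X ^ n) \<and> v \<in> K q}" by blast
    qed
    show "{u + v | u v. u \<in> K (?X ^ n) \<and> v \<in> K q} \<subseteq> G"
      using subspace_add[OF Gs] by (auto simp: K_def)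
  qed
  ultimately show ?thesis
    unfolding reducible_def using ideal[of "?X ^ n"] ideal[of q] y(2) z(2) by blast
qed

end

section \<open>The complex case\<close>

locale complex_metric_lie_algebra = metric_lie_algebra scale bracket g
  for scale :: "complex \<Rightarrow> 'a::ab_group_add \<Rightarrow> 'a" and bracket g
begin

text \<open>The segments through \<open>c\<close> avoid singular maps if no eigenvalue of \<open>\<phi>\<close> is a negative real
  multiple of \<open>c\<close>.\<close>

lemma isometric_if_solitary:
  assumes sol: "solitary g" and \<phi>: "sa_map \<phi>" "inj \<phi>"
  shows "isometric g (form \<phi>)"
proof -
  let ?S = "{c. \<exists>x. x \<noteq> 0 \<and> \<phi> x = scale c x}"
  \<comment> \<open>A slope s that no eigenvalue has keeps nonzero real multiples of 1 + i s out of
    the spectrum. Purely imaginary eigenvalues contribute the value 0 by the convention on division,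
    which merely excludes s = 0.\<close>
  have "finite ((\<lambda>\<mu>. Im \<mu> / Re \<mu>) ` ?S)"
    using finite_eigenvalues[OF sa_map_lin[OF \<phi>(1)]] by simp
  then obtain s where s: "s \<notin> (\<lambda>\<mu>. Im \<mu> / Re \<mu>) ` ?S"
    using ex_new_if_finite[OF infinite_UNIV_char_0] by blast
  define c where "c = Complex 1 s"
  have sc: "sa_map (scale c)" by (rule sa_map_scale[OF sa_map_id])
  have "isometric (form \<phi>) (form (scale c))"
  proof (rule isometric_line[OF sol \<phi>(1) sc])
    fix t :: real and x
    assume t: "0 \<le> t" "t \<le> 1" and 0: "scale (of_real (1 - t)) (\<phi> x) + scale (of_real t) (scale c x) = 0"
    show "x = 0"
    proof (rule ccontr)
      assume "x \<noteq> 0"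
      then have "\<phi> x \<noteq> 0" using \<phi>(2) lin_inj_iff[OF sa_map_lin[OF \<phi>(1)]] by blast
      have "c \<noteq> 0" by (simp add: c_def complex_eq_iff)
      have "t \<noteq> 0" using 0 \<open>\<phi> x \<noteq> 0\<close> by auto
      have "t \<noteq> 1" using 0 \<open>x \<noteq> 0\<close> \<open>c \<noteq> 0\<close> by auto
      \<comment> \<open>A singular point on the segment would give \<phi> the eigenvalue r
        c.\<close>
      define r where "r = - t / (1 - t)"
      have "\<phi> x = scale (of_real r * c) x"
      proof -
        have "scale (of_real (1 - t)) (\<phi> x) = scale (- of_real t * c) x"
          using 0 by (simp add: eq_neg_iff_add_eq_0)
        then have "scale (of_real (1 / (1 - t))) (scale (of_real (1 - t)) (\<phi> x)) =
            scale (of_real (1 / (1 - t)) * (- of_real t * c)) x" by simp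
        moreover have "of_real (1 / (1 - t)) * complex_of_real (1 - t) = 1"
          using \<open>t \<noteq> 1\<close> unfolding of_real_mult[symmetric] by simp
        moreover have "of_real (1 / (1 - t)) * (- of_real t * c) = of_real r * c"
          by (simp add: r_def)
        ultimately show ?thesis by (simp only: scale_scale scale_one)
      qed
      then have "of_real r * c \<in> ?S" using \<open>x \<noteq> 0\<close> by blast
      moreover have "Im (of_real r * c) / Re (of_real r * c) = s"
        using \<open>t \<noteq> 0\<close> \<open>t \<noteq> 1\<close> by (simp add: c_def r_def)
      ultimately show False using s by blast
    qed
  qed
  \<comment> \<open>On the segment from c to 1 the real part stays equal to 1, so 0 is not
    met.\<close>
  moreover have "isometric (form (scale c)) (form (\<lambda>x. x))"
  proof (rule isometric_line[OF sol sc sa_map_id])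
    fix t :: real and x
    assume "scale (of_real (1 - t)) (scale c x) + scale (of_real t) x = 0"
    then have "scale (of_real (1 - t) * c + of_real t) x = 0" by (simp add: scale_left_distrib)
    moreover have "Re (of_real (1 - t) * c + of_real t) = 1" by (simp add: c_def)
    then have "of_real (1 - t) * c + of_real t \<noteq> 0" by (metis zero_complex.sel(1) zero_neq_one)
    ultimately show "x = 0" by simp
  qed
  ultimately show ?thesis using isometric_trans isometric_sym by blast
qed

lemma solitary_iff_unique:
  "solitary g \<longleftrightarrow> (\<forall>g'. ad_invariant_metric g' \<longrightarrow> isometric g g')"
proof
  assume sol: "solitary g"
  show "\<forall>g'. ad_invariant_metric g' \<longrightarrow> isometric g g'"
  proof (intro allI impI)
    fix g' assume "ad_invariant_metric g'"
    then obtain \<phi> where \<phi>: "sa_map \<phi>" "inj \<phi>" and "\<And>x y. g' x y = g (\<phi> x) y"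
      by (rule sa_map_of_metric) blast
    then have "g' = form \<phi>" by (simp add: fun_eq_iff)
    then show "isometric g g'" using isometric_if_solitary[OF sol \<phi>] by simp
  qed
next
  assume *: "\<forall>g'. ad_invariant_metric g' \<longrightarrow> isometric g g'"
  show "solitary g"
  proof (rule solitary_if_finitely_many_classes[of "\<lambda>c. of_real (ln (cmod c))" "{g}"])
    show "\<exists>D. log_derivation scale f (\<lambda>c. of_real (ln (cmod c))) D"
      if "lin f" "inj f" "p \<noteq> 0" "\<And>x. poly_map p f x = 0" for f p
      using log_modulus_complex[OF vector_space_axioms that] .
    show "complex_of_real (ln (cmod (2 ^ n / 2 ^ m))) \<noteq> 0" if "m < n" for m n :: nat
    proof -
      have "(2::real) ^ m < 2 ^ n" using that by simp
      then have "1 < (2::real) ^ n / 2 ^ m" by simp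
      then have "0 < ln ((2::real) ^ n / 2 ^ m)" by (rule ln_gt_zero)
      then show ?thesis by (simp add: norm_divide norm_power)
    qed
  qed (use * in auto)
qed

end

section \<open>The real case\<close>

locale real_metric_lie_algebra = metric_lie_algebra scale bracket g
  for scale :: "real \<Rightarrow> 'a::ab_group_add \<Rightarrow> 'a" and bracket g
begin

lemma solitary_if_finitely_many_classes_real:
  assumes "finite H" and "\<And>g'. ad_invariant_metric g' \<Longrightarrow> \<exists>h\<in>H. isometric h g'"
  shows "solitary g"
proof (rule solitary_if_finitely_many_classes[OF _ _ assms, of "\<lambda>c. ln \<bar>c\<bar>"])
  show "\<exists>D. log_derivation scale f (\<lambda>c. ln \<bar>c\<bar>) D"
    if "lin f" "inj f" "p \<noteq> 0" "\<And>x. poly_map p f x = 0" for f p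
    using log_modulus_real[OF vector_space_axioms that] .
  show "ln \<bar>2 ^ n / 2 ^ m :: real\<bar> \<noteq> 0" if "m < n" for m n :: nat
  proof -
    have "(2::real) ^ m < 2 ^ n" using that by simp
    then have "1 < (2::real) ^ n / 2 ^ m" by simp
    then have "0 < ln ((2::real) ^ n / 2 ^ m)" by (rule ln_gt_zero)
    then show ?thesis by simp
  qed
qed simp_all

text \<open>If \<open>\<phi> + t P\<close> and \<open>\<phi> - s P\<close> were both singular, \<open>P \<phi>\<^sup>-\<^sup>1 P\<close> would have both a negative and a
  positive eigenvalue on the irreducible ideal \<open>range P\<close>.\<close>

lemma definite_direction:
  assumes \<phi>: "sa_map \<phi>" "inj \<phi>" and P: "sa_map P" "\<And>x. P (P x) = P x" and irr: "irreducible (range P)"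
  shows "\<exists>\<epsilon>. (\<epsilon> = 1 \<or> \<epsilon> = - 1) \<and> (\<forall>t\<ge>0. \<forall>x. \<phi> x + scale (t * \<epsilon>) (P x) = 0 \<longrightarrow> x = 0)"
proof (rule ccontr)
  assume neg: "\<not> ?thesis"
  have bij: "bij \<phi>" by (rule inj_imp_bij[OF sa_map_lin[OF \<phi>(1)] \<phi>(2)])
  note ad = sa_map_ad[OF P(1)] and inv = ad_invariant_map_inv[OF sa_map_ad[OF \<phi>(1)] bij]
  define \<omega> where "\<omega> x = P (inv \<phi> (P x))" for x
  have \<omega>: "ad_invariant_map \<omega>"
    unfolding \<omega>_def by (rule ad_invariant_map_comp[OF ad ad_invariant_map_comp[OF inv ad]])
  \<comment> \<open>If (\<phi> + t \<epsilon> P) x = 0, then x is - t \<epsilon> times the inverse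
    of \<phi> applied to P x. Applying P shows that P x is an eigenvector of \<omega> with
    eigenvalue - \<epsilon> / t, so the two signs yield eigenvalues of opposite sign.\<close>
  have ev: "\<exists>y\<in>range P. \<exists>t>0. y \<noteq> 0 \<and> \<omega> y = scale (- \<epsilon> / t) y" if \<epsilon>: "\<epsilon> = 1 \<or> \<epsilon> = - 1" for \<epsilon>
  proof -
    obtain t x where t: "0 \<le> t" and x: "\<phi> x + scale (t * \<epsilon>) (P x) = 0" "x \<noteq> 0"
      using neg \<epsilon> by blast
    have "\<phi> x \<noteq> 0" using x(2) \<phi>(2) lin_inj_iff[OF sa_map_lin[OF \<phi>(1)]] by blast
    then have "t \<noteq> 0" "P x \<noteq> 0" using x(1) by auto
    have "\<phi> x = scale (- (t * \<epsilon>)) (P x)" using x(1) by (simp add: eq_neg_iff_add_eq_0)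
    then have "inv \<phi> (\<phi> x) = scale (- (t * \<epsilon>)) (inv \<phi> (P x))"
      by (simp only: hom_scale[OF ad_invariant_map_lin[OF inv]])
    then have "x = scale (- (t * \<epsilon>)) (inv \<phi> (P x))" using \<phi>(2) by simp
    from arg_cong[OF this, of P] have "P x = scale (- (t * \<epsilon>)) (\<omega> (P x))"
      by (simp only: \<omega>_def P(2) hom_scale[OF sa_map_lin[OF P(1)]])
    from arg_cong[OF this, of "scale (- \<epsilon> / t)"]
    have "scale (- \<epsilon> / t) (P x) = scale ((- \<epsilon> / t) * (- (t * \<epsilon>))) (\<omega> (P x))"
      by (simp only: scale_scale)
    also have "(- \<epsilon> / t) * (- (t * \<epsilon>)) = 1" using \<epsilon> \<open>t \<noteq> 0\<close> by auto
    finally have "\<omega> (P x) = scale (- \<epsilon> / t) (P x)" by simp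
    then show ?thesis using t \<open>t \<noteq> 0\<close> \<open>P x \<noteq> 0\<close> by (intro bexI[of _ "P x"] exI[of _ t]) auto
  qed
  obtain y s where y: "y \<in> range P" "s > 0" "y \<noteq> 0" "\<omega> y = scale (- 1 / s) y" using ev[OF disjI1[OF refl]] by blast
  obtain z t where z: "z \<in> range P" "t > 0" "z \<noteq> 0" "\<omega> z = scale (- (- 1) / t) z" using ev[OF disjI2[OF refl]] by blast
  have "- 1 / s < 0" "0 < - (- 1) / t" using y(2) z(2) by simp_all
  then have "- 1 / s \<noteq> - (- 1) / t" by linarith
  moreover have "lie_ideal UNIV (range P)"
  proof -
    have "bracket x (P y) \<in> range P" for x y
      unfolding ad_invariant_map_right[OF ad, symmetric] by blast
    moreover have "subspace (range P)"
      using sa_map_lin[OF P(1)] module_hom.subspace_image[of scale scale P UNIV]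
      by (simp add: module_hom_iff_linear)
    ultimately show ?thesis by (auto simp: lie_ideal_def)
  qed
  moreover have "\<omega> x \<in> range P" for x by (simp add: \<omega>_def)
  ultimately have "reducible (range P)"
    using reducible_of_eigenvalues[OF \<omega> _ _ y(1,3,4) z(1,3,4)] by blast
  then show False using irr by blast
qed

text \<open>The terms T \<epsilon> i P i are added to \<phi> one at a time, with \<epsilon> i chosen
  by \<open>definite_direction\<close> for the map reached so far. That lemma controls the entire
  ray, so T may be fixed in advance, large enough that the last segment, to the signed sum of
  projections, avoids singular maps.\<close>

lemma isometric_signed_sum:
  fixes k :: nat
  assumes sol: "solitary g" and P: "\<And>i. i < k \<Longrightarrow> sa_map (P i)"
    and orth: "\<And>i j x. i < k \<Longrightarrow> j < k \<Longrightarrow> P i (P j x) = (if i = j then P i x else 0)"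
    and sum: "\<And>x. (\<Sum>i<k. P i x) = x"
    and irr: "\<And>i. i < k \<Longrightarrow> irreducible (range (P i))"
    and \<phi>: "sa_map \<phi>" "inj \<phi>"
  shows "\<exists>\<epsilon>. (\<forall>i<k. \<epsilon> i = 1 \<or> \<epsilon> i = - 1) \<and>
           isometric (form (\<lambda>x. \<Sum>i<k. scale (\<epsilon> i) (P i x))) (form \<phi>)"
proof -
  obtain Basis where Basis: "finite_dimensional_vector_space scale Basis" using finite_dim by blast
  interpret N: normed_fd_space scale Basis using Basis by (rule normed_fd_space.intro)
  have "\<forall>i. \<exists>c. i < k \<longrightarrow> 0 \<le> c \<and> (\<forall>x. N.vec_norm (P i (\<phi> x)) \<le> c * N.vec_norm x)"
  proof
    fix i
    show "\<exists>c. i < k \<longrightarrow> 0 \<le> c \<and> (\<forall>x. N.vec_norm (P i (\<phi> x)) \<le> c * N.vec_norm x)"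
    proof (cases "i < k")
      case True
      show ?thesis
        by (rule N.linear_bounded[OF lin_comp[OF sa_map_lin[OF P[OF True]] sa_map_lin[OF \<phi>(1)]]]) blast
    qed blast
  qed
  then obtain c where "\<forall>i. i < k \<longrightarrow> 0 \<le> c i \<and> (\<forall>x. N.vec_norm (P i (\<phi> x)) \<le> c i * N.vec_norm x)"
    by (rule choice[THEN exE])
  then have c: "\<And>i. i < k \<Longrightarrow> 0 \<le> c i" "\<And>i x. i < k \<Longrightarrow> N.vec_norm (P i (\<phi> x)) \<le> c i * N.vec_norm x"
    by blast+
  \<comment> \<open>Chosen so that T - 1 bounds E \<phi> for every choice of signs in the signed sum
    E.\<close>
  define T where "T = (\<Sum>i<k. c i) + 1"
  have "0 \<le> (\<Sum>i<k. c i)" using c(1) by (intro sum_nonneg) simp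
  then have T: "0 < T" by (simp add: T_def)
  let ?\<Phi> = "\<lambda>m \<epsilon> x. \<phi> x + (\<Sum>i<m. scale (T * \<epsilon> i) (P i x))"
  have "\<exists>\<epsilon>. (\<forall>i<m. \<epsilon> i = 1 \<or> \<epsilon> i = - 1) \<and> inj (?\<Phi> m \<epsilon>) \<and> isometric (form (?\<Phi> m \<epsilon>)) (form \<phi>)" if "m \<le> k" for m
    using that
  proof (induction m)
    case 0
    then show ?case using \<phi>(2) isometric_refl by simp
  next
    case (Suc m)
    then have m: "m < k" by simp
    obtain \<epsilon> where \<epsilon>: "\<forall>i<m. \<epsilon> i = 1 \<or> \<epsilon> i = - 1" "inj (?\<Phi> m \<epsilon>)" "isometric (form (?\<Phi> m \<epsilon>)) (form \<phi>)"
      using Suc by auto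
    have sa: "sa_map (?\<Phi> m \<epsilon>)"
      using m by (intro sa_map_add[OF \<phi>(1) sa_map_sum] sa_map_scale P) simp
    obtain \<delta> where \<delta>: "\<delta> = 1 \<or> \<delta> = - 1" "\<And>t x. 0 \<le> t \<Longrightarrow> ?\<Phi> m \<epsilon> x + scale (t * \<delta>) (P m x) = 0 \<Longrightarrow> x = 0"
    proof -
      have "P m (P m x) = P m x" for x using orth[OF m m] by simp
      from definite_direction[OF sa \<epsilon>(2) P[OF m] this irr[OF m]] show ?thesis using that by blast
    qed
    define \<epsilon>' where "\<epsilon>' = \<epsilon>(m := \<delta>)"
    have step: "?\<Phi> (Suc m) \<epsilon>' x = ?\<Phi> m \<epsilon> x + scale (T * \<delta>) (P m x)" for x
      by (simp add: \<epsilon>'_def add.assoc)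
    have "isometric (form (?\<Phi> m \<epsilon>)) (form (\<lambda>x. ?\<Phi> m \<epsilon> x + scale (T * \<delta>) (P m x)))"
    proof (rule isometric_segment[OF sol sa sa_map_scale[OF P[OF m]]])
      fix t :: real and x
      assume t: "0 \<le> t" "t \<le> 1" and 0: "?\<Phi> m \<epsilon> x + scale (of_real t) (scale (T * \<delta>) (P m x)) = 0"
      have "scale (of_real t) (scale (T * \<delta>) (P m x)) = scale (t * T * \<delta>) (P m x)"
        by (simp add: mult.assoc)
      with 0 have "?\<Phi> m \<epsilon> x + scale (t * T * \<delta>) (P m x) = 0" by (simp only:)
      then show "x = 0" by (rule \<delta>(2)[rotated]) (use t T in simp)
    qed
    then have "isometric (form (?\<Phi> (Suc m) \<epsilon>')) (form \<phi>)"
      unfolding step using \<epsilon>(3) isometric_sym isometric_trans by blast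
    moreover have "inj (?\<Phi> (Suc m) \<epsilon>')"
    proof -
      have L: "lin (?\<Phi> (Suc m) \<epsilon>')"
        unfolding step by (rule sa_map_lin[OF sa_map_add[OF sa sa_map_scale[OF P[OF m]]]])
      have "?\<Phi> (Suc m) \<epsilon>' x = 0 \<longrightarrow> x = 0" for x
        unfolding step using \<delta>(2)[of T x] T by (intro impI) simp
      then show ?thesis unfolding lin_inj_iff[OF L] by (intro allI)
    qed
    moreover have "\<forall>i<Suc m. \<epsilon>' i = 1 \<or> \<epsilon>' i = - 1" using \<epsilon>(1) \<delta>(1) by (auto simp: \<epsilon>'_def less_Suc_eq)
    ultimately show ?case by blast
  qed
  from this[of k] obtain \<epsilon> where \<epsilon>: "\<And>i. i < k \<Longrightarrow> \<epsilon> i = 1 \<or> \<epsilon> i = - 1"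
    and iso: "isometric (form (?\<Phi> k \<epsilon>)) (form \<phi>)" by auto
  \<comment> \<open>The signed sum is an involution: the projections are orthogonal and the signs
    square to 1.\<close>
  define E where "E x = (\<Sum>i<k. scale (\<epsilon> i) (P i x))" for x
  have saE: "sa_map E" unfolding E_def by (intro sa_map_sum sa_map_scale P) simp
  have EE: "E (E x) = x" for x
  proof -
    have "P i (E x) = scale (\<epsilon> i) (P i x)" if "i < k" for i
    proof -
      have "P i (E x) = (\<Sum>j<k. scale (\<epsilon> j) (P i (P j x)))"
        unfolding E_def by (simp add: hom_simps[OF sa_map_lin[OF P[OF that]]])
      also have "\<dots> = (\<Sum>j<k. if i = j then scale (\<epsilon> i) (P i x) else 0)"
        using orth[OF that] by (intro sum.cong) auto
      finally show ?thesis using that by simp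
    qed
    then have "E (E x) = (\<Sum>i<k. scale (\<epsilon> i * \<epsilon> i) (P i x))" unfolding E_def[of "E x"] by simp
    also have "\<dots> = (\<Sum>i<k. P i x)"
    proof (rule sum.cong[OF refl])
      fix i assume "i \<in> {..<k}"
      then have "\<epsilon> i * \<epsilon> i = 1" using \<epsilon>[of i] by auto
      then show "scale (\<epsilon> i * \<epsilon> i) (P i x) = P i x" by simp
    qed
    finally show ?thesis by (simp add: sum)
  qed
  have E\<phi>: "N.vec_norm (E (\<phi> x)) \<le> (T - 1) * N.vec_norm x" for x
  proof -
    have "N.vec_norm (E (\<phi> x)) \<le> (\<Sum>i<k. N.vec_norm (scale (\<epsilon> i) (P i (\<phi> x))))"
      unfolding E_def by (rule N.vec_norm_sum)
    also have "\<dots> \<le> (\<Sum>i<k. c i * N.vec_norm x)"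
    proof (rule sum_mono)
      fix i assume "i \<in> {..<k}"
      then have "\<bar>\<epsilon> i\<bar> = 1" "N.vec_norm (P i (\<phi> x)) \<le> c i * N.vec_norm x"
        using \<epsilon>[of i] c(2)[of i x] by auto
      then show "N.vec_norm (scale (\<epsilon> i) (P i (\<phi> x))) \<le> c i * N.vec_norm x"
        by (simp add: N.vec_norm_scale)
    qed
    finally show ?thesis by (simp add: T_def sum_distrib_right)
  qed
  have TE: "(\<Sum>i<k. scale (T * \<epsilon> i) (P i x)) = scale T (E x)" for x
    by (simp add: E_def scale_sum_right)
  have sa: "sa_map (?\<Phi> k \<epsilon>)" unfolding TE by (rule sa_map_add[OF \<phi>(1) sa_map_scale[OF saE]])
  have "isometric (form (?\<Phi> k \<epsilon>)) (form E)"
  proof (rule isometric_line[OF sol sa saE])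
    fix t :: real and x
    assume t: "0 \<le> t" "t \<le> 1" and 0: "scale (of_real (1 - t)) (?\<Phi> k \<epsilon> x) + scale (of_real t) (E x) = 0"
    \<comment> \<open>On the segment the map is u E + (1 - t) \<phi>. Applying E to a kernel vector
      x bounds u |x| by (1 - t) (T - 1) |x|, whereas u exceeds that factor by exactly 1.\<close>
    define u where "u = (1 - t) * T + t"
    have "scale u (E x) = scale (- (1 - t)) (\<phi> x)"
      using 0 unfolding TE u_def
      by (simp add: scale_right_distrib scale_left_distrib scale_left_diff_distrib algebra_simps
          eq_neg_iff_add_eq_0)
    then have "E (scale u (E x)) = E (scale (- (1 - t)) (\<phi> x))" by (rule arg_cong)
    then have "scale u x = scale (- (1 - t)) (E (\<phi> x))"
      by (simp only: hom_scale[OF sa_map_lin[OF saE]] EE)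
    then have "N.vec_norm (scale u x) = N.vec_norm (scale (- (1 - t)) (E (\<phi> x)))" by (rule arg_cong)
    then have "\<bar>u\<bar> * N.vec_norm x = \<bar>1 - t\<bar> * N.vec_norm (E (\<phi> x))"
      by (simp only: N.vec_norm_scale real_norm_def abs_minus_cancel)
    also have "\<dots> \<le> \<bar>1 - t\<bar> * ((T - 1) * N.vec_norm x)" by (intro mult_left_mono E\<phi>) simp
    finally have "u * N.vec_norm x \<le> (1 - t) * (T - 1) * N.vec_norm x"
      using t T by (simp add: u_def mult.assoc)
    then have "(u - (1 - t) * (T - 1)) * N.vec_norm x \<le> 0" by (simp only: left_diff_distrib diff_le_0_iff_le)
    moreover have "u - (1 - t) * (T - 1) = 1" by (simp add: u_def algebra_simps)
    ultimately have "N.vec_norm x \<le> 0" by simp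
    then show "x = 0" using N.vec_norm_eq_0 N.vec_norm_nonneg[of x] by (meson order_antisym)
  qed
  then have "isometric (form E) (form \<phi>)" using iso isometric_sym isometric_trans by blast
  then show ?thesis using \<epsilon> unfolding E_def by blast
qed

end

section \<open>From an orthogonal decomposition to its projections\<close>

lemma (in lie_algebra) component_eqI:
  assumes ds: "direct_sum k G" and c: "\<And>i. i < k \<Longrightarrow> c i \<in> G i" and x: "x = (\<Sum>i<k. c i)" and "i < k"
  shows "component k G i x = c i"
proof -
  have ex1: "\<exists>!c. c \<in> (\<Pi>\<^sub>E i\<in>{..<k}. G i) \<and> x = (\<Sum>i<k. c i)"
    using ds unfolding direct_sum_def by blast
  have "restrict c {..<k} \<in> (\<Pi>\<^sub>E i\<in>{..<k}. G i) \<and> x = (\<Sum>i<k. restrict c {..<k} i)"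
    using c x by simp
  with ex1 have "(THE c. c \<in> (\<Pi>\<^sub>E i\<in>{..<k}. G i) \<and> x = (\<Sum>i<k. c i)) = restrict c {..<k}"
    using theI'[OF ex1] by (metis (no_types, lifting))
  then show ?thesis
    using \<open>i < k\<close> by (simp add: component_def)
qed

context real_metric_lie_algebra
begin

text \<open>The component maps satisfy the hypotheses of \<open>isometric_signed_sum\<close>: they
  are ad-invariant because the summands are ideals, self-adjoint because the summands are
  orthogonal, and their ranges are the irreducible summands.\<close>

lemma isometric_component_signs:
  assumes sol: "solitary g" and dec: "irreducible_orthogonal_decomposition g k G"
    and g': "ad_invariant_metric g'"
  shows "\<exists>\<epsilon>. (\<forall>i<k. \<epsilon> i = 1 \<or> \<epsilon> i = - 1) \<and>
           isometric (\<lambda>x y. \<Sum>i<k. \<epsilon> i * metric_part g k G i x y) g'"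
proof -
  define P where "P = component k G"
  have ds: "direct_sum k G" and id: "\<And>i. i < k \<Longrightarrow> lie_ideal UNIV (G i)"
    and irr: "\<And>i. i < k \<Longrightarrow> irreducible (G i)"
    and orth: "\<And>i j x y. i < k \<Longrightarrow> j < k \<Longrightarrow> i \<noteq> j \<Longrightarrow> x \<in> G i \<Longrightarrow> y \<in> G j \<Longrightarrow> g x y = 0"
    using dec unfolding irreducible_orthogonal_decomposition_def by auto
  have sub: "subspace (G i)" if "i < k" for i using ds that by (simp add: direct_sum_def)
  have PG: "P i x \<in> G i" if "i < k" for i x using component_in[OF ds that] by (simp add: P_def)
  have Psum: "(\<Sum>i<k. P i x) = x" for x using sum_component[OF ds] by (simp add: P_def)
  have eqI: "P i x = c i" if "\<And>i. i < k \<Longrightarrow> c i \<in> G i" "x = (\<Sum>i<k. c i)" "i < k" for c i x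
    unfolding P_def by (rule component_eqI[OF ds that])
  have lin: "lin (P i)" if "i < k" for i
  proof (rule linI)
    show "P i (x + y) = P i x + P i y" for x y
      by (rule eqI[of "\<lambda>i. P i x + P i y"]) (simp_all add: subspace_add[OF sub] PG that sum.distrib Psum)
    show "P i (scale c x) = scale c (P i x)" for c x
      by (rule eqI[of "\<lambda>i. scale c (P i x)"])
        (simp_all add: subspace_scale[OF sub] PG that scale_sum_right[symmetric] Psum)
  qed
  have PP: "P i (P j x) = (if i = j then P i x else 0)" if "i < k" "j < k" for i j x
  proof -
    have "P i (P j x) = (if i = j then P j x else 0)"
      by (rule eqI[of "\<lambda>l. if l = j then P j x else 0"]) (simp_all add: PG subspace_0[OF sub] that)
    then show ?thesis by simp
  qed
  have ad: "P i (bracket x y) = bracket x (P i y)" if "i < k" for i x y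
  proof (rule eqI[of "\<lambda>i. bracket x (P i y)", OF _ _ that])
    show "bracket x (P i y) \<in> G i" if "i < k" for i
      using id[OF that] PG[OF that] by (simp add: lie_ideal_def)
    have "bracket x y = bracket x (\<Sum>i<k. P i y)" by (simp add: Psum)
    then show "bracket x y = (\<Sum>i<k. bracket x (P i y))"
      by (simp only: hom_sum[OF bilin_right[OF bracket_bilin]])
  qed
  have gP: "g (P i x) y = g (P i x) (P i y)" if "i < k" for i x y
  proof -
    have "g (P i x) y = g (P i x) (\<Sum>j<k. P j y)" by (simp add: Psum)
    also have "\<dots> = (\<Sum>j<k. g (P i x) (P j y))" by (rule metric_sum_right[OF metric])
    also have "\<dots> = (\<Sum>j<k. if i = j then g (P i x) (P i y) else 0)"
      using orth PG that by (intro sum.cong) auto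
    finally show ?thesis using that by simp
  qed
  have sa: "sa_map (P i)" if "i < k" for i
  proof -
    have "g (P i x) y = g x (P i y)" for x y
      using gP[OF that, of x y] gP[OF that, of y x] g_sym[of x "P i y"] g_sym[of "P i x" "P i y"] by simp
    then show ?thesis using lin[OF that] ad[OF that] by (simp add: sa_map_def ad_invariant_map_def)
  qed
  have "range (P i) = G i" if "i < k" for i
  proof
    show "G i \<subseteq> range (P i)"
    proof
      fix x assume "x \<in> G i"
      then have "P i x = (if i = i then x else 0)"
        by (intro eqI[of "\<lambda>l. if l = i then x else 0"]) (simp_all add: subspace_0[OF sub] that)
      then show "x \<in> range (P i)" by (intro range_eqI[of _ _ x]) simp
    qed
  qed (use PG that in auto)
  then have irrP: "irreducible (range (P i))" if "i < k" for i using irr that by simp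
  obtain \<phi> where \<phi>: "sa_map \<phi>" "inj \<phi>" and "\<And>x y. g' x y = g (\<phi> x) y"
    using sa_map_of_metric[OF g'] by blast
  then have "g' = form \<phi>" by (simp add: fun_eq_iff)
  moreover obtain \<epsilon> where \<epsilon>: "\<forall>i<k. \<epsilon> i = 1 \<or> \<epsilon> i = - 1"
    and iso: "isometric (form (\<lambda>x. \<Sum>i<k. scale (\<epsilon> i) (P i x))) (form \<phi>)"
    using isometric_signed_sum[of k P \<phi>, OF sol sa PP Psum irrP \<phi>] by blast
  moreover have "form (\<lambda>x. \<Sum>i<k. scale (\<epsilon> i) (P i x)) = (\<lambda>x y. \<Sum>i<k. \<epsilon> i * metric_part g k G i x y)"
  proof (intro ext)
    fix x y
    have "g (P i x) y = metric_part g k G i x y" if "i < k" for i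
      using gP[OF that, of x y] by (simp only: metric_part_def P_def)
    then have "(\<Sum>i<k. \<epsilon> i * g (P i x) y) = (\<Sum>i<k. \<epsilon> i * metric_part g k G i x y)"
      by (intro sum.cong refl) simp
    then show "g (\<Sum>i<k. scale (\<epsilon> i) (P i x)) y = (\<Sum>i<k. \<epsilon> i * metric_part g k G i x y)"
      by (simp only: g_simps)
  qed
  ultimately show ?thesis by auto
qed

text \<open>The case k = 1, with the identity as the only projection.\<close>

lemma isometric_up_to_sign:
  assumes sol: "solitary g" and irr: "irreducible UNIV" and g': "ad_invariant_metric g'"
  shows "isometric g g' \<or> isometric (\<lambda>x y. - g x y) g'"
proof -
  obtain \<phi> where \<phi>: "sa_map \<phi>" "inj \<phi>" and "\<And>x y. g' x y = g (\<phi> x) y"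
    using sa_map_of_metric[OF g'] by blast
  then have "g' = form \<phi>" by (simp add: fun_eq_iff)
  moreover obtain \<epsilon> where "\<epsilon> (0::nat) = 1 \<or> \<epsilon> 0 = - 1"
    and "isometric (form (\<lambda>x. \<Sum>i<1. scale (\<epsilon> i) x)) (form \<phi>)"
    using isometric_signed_sum[of 1 "\<lambda>i x. x" \<phi>, OF sol sa_map_id _ _ _ \<phi>] irr by auto
  ultimately show ?thesis by (auto simp: g_simps)
qed

end

section \<open>The equivalences for the three cases\<close>

lemma real_solitary_irreducible_iff:
  fixes scale :: "real \<Rightarrow> 'a::ab_group_add \<Rightarrow> 'a"
  assumes "finite_dim_lie_algebra scale br" and "lie_algebra.ad_invariant_metric scale br g"
    and irr: "lie_algebra.irreducible scale br UNIV"
  shows "lie_algebra.solitary scale br g \<longleftrightarrow>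
    (\<forall>g'. lie_algebra.ad_invariant_metric scale br g' \<longrightarrow>
      (\<exists>\<psi>. lie_algebra.automorphism scale br \<psi> \<and>
        ((\<forall>x y. g' x y = g (\<psi> x) (\<psi> y)) \<or> (\<forall>x y. g' x y = - g (\<psi> x) (\<psi> y)))))"
proof -
  interpret real_metric_lie_algebra scale br g
    using assms by (intro real_metric_lie_algebra.intro metric_lie_algebra.intro metric_lie_algebra_axioms.intro)
  have iso: "(\<exists>\<psi>. automorphism \<psi> \<and> ((\<forall>x y. g' x y = g (\<psi> x) (\<psi> y)) \<or> (\<forall>x y. g' x y = - g (\<psi> x) (\<psi> y))))
      \<longleftrightarrow> isometric g g' \<or> isometric (\<lambda>x y. - g x y) g'" for g'
    unfolding isometric_def by blast
  show ?thesis
    unfolding iso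
  proof
    assume "\<forall>g'. ad_invariant_metric g' \<longrightarrow> isometric g g' \<or> isometric (\<lambda>x y. - g x y) g'"
    then show "solitary g"
      by (intro solitary_if_finitely_many_classes_real[of "{g, \<lambda>x y. - g x y}"]) auto
  qed (use isometric_up_to_sign irr in blast)
qed

lemma real_solitary_decomposition_iff:
  fixes scale :: "real \<Rightarrow> 'a::ab_group_add \<Rightarrow> 'a"
  assumes "finite_dim_lie_algebra scale br" and "lie_algebra.ad_invariant_metric scale br g"
    and dec: "lie_algebra.irreducible_orthogonal_decomposition scale br g k G"
  shows "lie_algebra.solitary scale br g \<longleftrightarrow>
    (\<forall>g'. lie_algebra.ad_invariant_metric scale br g' \<longrightarrow>
      (\<exists>\<psi> h \<epsilon>. lie_algebra.automorphism scale br \<psi> \<and> (\<forall>i<k. \<epsilon> i = 1 \<or> \<epsilon> i = - 1) \<and>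
        (\<forall>x y. h x y = (\<Sum>i<k. \<epsilon> i * metric_part g k G i x y)) \<and>
        (\<forall>x y. g' x y = h (\<psi> x) (\<psi> y))))"
proof -
  interpret real_metric_lie_algebra scale br g
    using assms by (intro real_metric_lie_algebra.intro metric_lie_algebra.intro metric_lie_algebra_axioms.intro)
  define h where "h \<epsilon> = (\<lambda>x y. \<Sum>i<k. \<epsilon> i * metric_part g k G i x y)" for \<epsilon>
  have iso: "(\<exists>\<psi> h' \<epsilon>. automorphism \<psi> \<and> (\<forall>i<k. \<epsilon> i = 1 \<or> \<epsilon> i = - 1) \<and>
        (\<forall>x y. h' x y = (\<Sum>i<k. \<epsilon> i * metric_part g k G i x y)) \<and> (\<forall>x y. g' x y = h' (\<psi> x) (\<psi> y)))
      \<longleftrightarrow> (\<exists>\<epsilon>. (\<forall>i<k. \<epsilon> i = 1 \<or> \<epsilon> i = - 1) \<and> isometric (h \<epsilon>) g')" for g'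
  proof -
    have "(\<forall>x y. h' x y = (\<Sum>i<k. \<epsilon> i * metric_part g k G i x y)) \<longleftrightarrow> h' = h \<epsilon>" for h' \<epsilon>
      by (simp add: h_def fun_eq_iff)
    then show ?thesis unfolding isometric_def by (simp only:) blast
  qed
  show ?thesis
    unfolding iso
  proof
    assume *: "\<forall>g'. ad_invariant_metric g' \<longrightarrow> (\<exists>\<epsilon>. (\<forall>i<k. \<epsilon> i = 1 \<or> \<epsilon> i = - 1) \<and> isometric (h \<epsilon>) g')"
    \<comment> \<open>Signs at indices from k on do not affect \<open>h\<close>; restricting to
      extensional families leaves finitely many choices.\<close>
    let ?H = "h ` (\<Pi>\<^sub>E i\<in>{..<k}. {1, - 1})"
    show "solitary g"
    proof (rule solitary_if_finitely_many_classes_real[of ?H])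
      show "finite ?H" by (intro finite_imageI finite_PiE) auto
      fix g' assume "ad_invariant_metric g'"
      then obtain \<epsilon> where \<epsilon>: "\<forall>i<k. \<epsilon> i = 1 \<or> \<epsilon> i = - 1" "isometric (h \<epsilon>) g'" using * by blast
      have "h (restrict \<epsilon> {..<k}) = h \<epsilon>" by (simp add: h_def)
      moreover have "restrict \<epsilon> {..<k} \<in> (\<Pi>\<^sub>E i\<in>{..<k}. {1, - 1})" using \<epsilon>(1) by auto
      ultimately show "\<exists>h\<in>?H. isometric h g'" using \<epsilon>(2) by (metis imageI)
    qed
  qed (use isometric_component_signs[OF _ dec] in \<open>simp add: h_def\<close>)
qed

lemma complex_solitary_iff:
  fixes scale :: "complex \<Rightarrow> 'a::ab_group_add \<Rightarrow> 'a"
  assumes "finite_dim_lie_algebra scale br" and "lie_algebra.ad_invariant_metric scale br g"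
  shows "lie_algebra.solitary scale br g \<longleftrightarrow>
    (\<forall>g'. lie_algebra.ad_invariant_metric scale br g' \<longrightarrow>
      (\<exists>\<psi>. lie_algebra.automorphism scale br \<psi> \<and> (\<forall>x y. g' x y = g (\<psi> x) (\<psi> y))))"
proof -
  interpret complex_metric_lie_algebra scale br g
    using assms by (intro complex_metric_lie_algebra.intro metric_lie_algebra.intro metric_lie_algebra_axioms.intro)
  show ?thesis using solitary_iff_unique by (simp only: isometric_def)
qed

theorem theorem2p17:
  fixes scC :: "complex \<Rightarrow> 'a::ab_group_add \<Rightarrow> 'a"
    and brC :: "'a \<Rightarrow> 'a \<Rightarrow> 'a"
    and gC :: "'a \<Rightarrow> 'a \<Rightarrow> complex"
    and scR :: "real \<Rightarrow> 'b::ab_group_add \<Rightarrow> 'b"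
    and brR :: "'b \<Rightarrow> 'b \<Rightarrow> 'b"
    and gR :: "'b \<Rightarrow> 'b \<Rightarrow> real"
    and k :: nat
    and G :: "nat \<Rightarrow> 'b set"
  shows
    "(finite_dim_lie_algebra scC brC \<and> lie_algebra.ad_invariant_metric scC brC gC \<longrightarrow>
        (lie_algebra.solitary scC brC gC \<longleftrightarrow>
          (\<forall>g'. lie_algebra.ad_invariant_metric scC brC g' \<longrightarrow>
            (\<exists>\<psi>. lie_algebra.automorphism scC brC \<psi> \<and>
              (\<forall>x y. g' x y = gC (\<psi> x) (\<psi> y))))))
     \<and>
     (finite_dim_lie_algebra scR brR \<and> lie_algebra.ad_invariant_metric scR brR gR \<and>
      lie_algebra.irreducible scR brR UNIV \<longrightarrow>
        (lie_algebra.solitary scR brR gR \<longleftrightarrow>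
          (\<forall>g'. lie_algebra.ad_invariant_metric scR brR g' \<longrightarrow>
            (\<exists>\<psi>. lie_algebra.automorphism scR brR \<psi> \<and>
              ((\<forall>x y. g' x y = gR (\<psi> x) (\<psi> y)) \<or>
               (\<forall>x y. g' x y = - gR (\<psi> x) (\<psi> y)))))))
     \<and>
     (finite_dim_lie_algebra scR brR \<and> lie_algebra.ad_invariant_metric scR brR gR \<and>
      lie_algebra.reducible scR brR UNIV \<and>
      lie_algebra.irreducible_orthogonal_decomposition scR brR gR k G \<longrightarrow>
        (lie_algebra.solitary scR brR gR \<longleftrightarrow>
          (\<forall>g'. lie_algebra.ad_invariant_metric scR brR g' \<longrightarrow>
            (\<exists>\<psi> h \<epsilon>. lie_algebra.automorphism scR brR \<psi> \<and>
              (\<forall>i<k. \<epsilon> i = 1 \<or> \<epsilon> i = -1) \<and>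
              (\<forall>x y. h x y = (\<Sum>i<k. \<epsilon> i * metric_part gR k G i x y)) \<and>
              (\<forall>x y. g' x y = h (\<psi> x) (\<psi> y))))))"
  using complex_solitary_iff[of scC brC gC] real_solitary_irreducible_iff[of scR brR gR]
    real_solitary_decomposition_iff[of scR brR gR k G]
  by (intro conjI impI; elim conjE) assumption+

end
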